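(* For every dimension $n$ and every $\alpha>0$ there exists a constant $C=C(n,\alpha)>0$ such that the following holds. Let $\Omega\subset\mathbb{R}^n$ be a bounded $\alpha$-asymmetric domain and let $x_0\in\Omega$ be a point of maximum of the first Dirichlet eigenfunction $\phi_{\lambda_1(\Omega)}>0$ of $\Omega$. Then the ball of radius $C\operatorname{inrad}(\Omega)$ centered at $x_0$ is inscribed in $\Omega$, i.e. $$B_{C\operatorname{inrad}(\Omega)}(x_0)\subseteq\Omega.$$
   Context: A domain is a nonempty connected open set. For $\alpha>0$, a bounded domain $\Omega\subset\mathbb{R}^n$ is called $\alpha$-asymmetric if for all $y\in\partial\Omega$ and all $r>0$, $\frac{|B_r(y)\setminus\Omega|}{|B_r(y)|}\ge\alpha$, where $B_r(y)$ is the ball of radius $r$ centered at $y$ and $|\cdot|$ is Lebesgue measure. $\lambda_1(\Omega)$ is the first eigenvalue of $-\Delta$ on $\Omega$ with Dirichlet boundary conditions and $\phi_{\lambda_1(\Omega)}$ the corresponding positive eigenfunction (ground state). $\operatorname{inrad}(\Omega)$ is the inner radius of $\Omega$, i.e. the supremum of the radii of balls contained in $\Omega$. *)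

theory Defs
  imports "HOL-Analysis.Analysis"
begin

definition domain :: "(real ^ 'n) set \<Rightarrow> bool" where
  "domain \<Omega> \<longleftrightarrow> \<Omega> \<noteq> {} \<and> open \<Omega> \<and> connected \<Omega>"

definition asymmetric :: "real \<Rightarrow> (real ^ 'n) set \<Rightarrow> bool" where
  "asymmetric \<alpha> \<Omega> \<longleftrightarrow>
     (\<forall>y \<in> frontier \<Omega>. \<forall>r > 0.
        measure lebesgue (ball y r - \<Omega>) / measure lebesgue (ball y r) \<ge> \<alpha>)"

definition inrad :: "(real ^ 'n) set \<Rightarrow> real" where
  "inrad \<Omega> = Sup {r. r > 0 \<and> (\<exists>x. ball x r \<subseteq> \<Omega>)}"

definition grad :: "(real ^ 'n \<Rightarrow> real) \<Rightarrow> real ^ 'n \<Rightarrow> real ^ 'n" where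
  "grad f x = (\<chi> i. frechet_derivative f (at x) (axis i 1))"

primrec Ck :: "nat \<Rightarrow> (real ^ 'n \<Rightarrow> real) \<Rightarrow> bool" where
  "Ck 0 f \<longleftrightarrow> continuous_on UNIV f"
| "Ck (Suc k) f \<longleftrightarrow> f differentiable_on UNIV \<and> (\<forall>i. Ck k (\<lambda>x. grad f x $ i))"

definition test_function :: "(real ^ 'n) set \<Rightarrow> (real ^ 'n \<Rightarrow> real) \<Rightarrow> bool" where
  "test_function \<Omega> \<psi> \<longleftrightarrow>
     (\<forall>k. Ck k \<psi>) \<and> compact (closure {x. \<psi> x \<noteq> 0}) \<and> closure {x. \<psi> x \<noteq> 0} \<subseteq> \<Omega>"

definition L2_on :: "(real ^ 'n) set \<Rightarrow> (real ^ 'n \<Rightarrow> 'b::euclidean_space) \<Rightarrow> bool" where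
  "L2_on \<Omega> f \<longleftrightarrow>
     f \<in> borel_measurable (lebesgue_on \<Omega>) \<and>
     integrable (lebesgue_on \<Omega>) (\<lambda>x. (norm (f x))\<^sup>2)"

definition L2_tendsto ::
    "(real ^ 'n) set \<Rightarrow> (nat \<Rightarrow> real ^ 'n \<Rightarrow> 'b::euclidean_space) \<Rightarrow> (real ^ 'n \<Rightarrow> 'b) \<Rightarrow> bool" where
  "L2_tendsto \<Omega> F f \<longleftrightarrow>
     (\<lambda>k. \<integral>x. (norm (F k x - f x))\<^sup>2 \<partial>lebesgue_on \<Omega>) \<longlonglongrightarrow> 0"

text \<open>\<open>H10 \<Omega> u g\<close>: \<open>u\<close> lies in the Sobolev space obtained as the closure of the test functions in
  the norm of \<open>H\<^sup>1(\<Omega>)\<close>, and \<open>g\<close> is its weak gradient. A limit in \<open>L\<^sup>2\<close> of gradients of test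
  functions that converge to \<open>u\<close> is automatically the distributional gradient of \<open>u\<close>, so \<open>g\<close> is
  determined by \<open>u\<close> up to null sets. Values outside \<open>\<Omega>\<close> are irrelevant.\<close>

definition H10 :: "(real ^ 'n) set \<Rightarrow> (real ^ 'n \<Rightarrow> real) \<Rightarrow> (real ^ 'n \<Rightarrow> real ^ 'n) \<Rightarrow> bool" where
  "H10 \<Omega> u g \<longleftrightarrow>
     L2_on \<Omega> u \<and> L2_on \<Omega> g \<and>
     (\<exists>\<psi>. (\<forall>k::nat. test_function \<Omega> (\<psi> k)) \<and>
          L2_tendsto \<Omega> \<psi> u \<and> L2_tendsto \<Omega> (\<lambda>k. grad (\<psi> k)) g)"

text \<open>Weak form of \<open>-\<Delta>u = \<lambda>u\<close> in \<open>\<Omega>\<close> with \<open>u = 0\<close> on the boundary.\<close>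

definition dirichlet_eigenfunction ::
    "(real ^ 'n) set \<Rightarrow> real \<Rightarrow> (real ^ 'n \<Rightarrow> real) \<Rightarrow> bool" where
  "dirichlet_eigenfunction \<Omega> l u \<longleftrightarrow>
     \<not> (AE x in lebesgue_on \<Omega>. u x = 0) \<and>
     (\<exists>g. H10 \<Omega> u g \<and>
        (\<forall>\<psi>. test_function \<Omega> \<psi> \<longrightarrow>
           (\<integral>x. g x \<bullet> grad \<psi> x \<partial>lebesgue_on \<Omega>) = l * (\<integral>x. u x * \<psi> x \<partial>lebesgue_on \<Omega>)))"

definition dirichlet_eigenvalue :: "(real ^ 'n) set \<Rightarrow> real \<Rightarrow> bool" where
  "dirichlet_eigenvalue \<Omega> l \<longleftrightarrow> (\<exists>u. dirichlet_eigenfunction \<Omega> l u)"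

text \<open>On a bounded domain the infimum is attained: the spectrum is discrete and positive.\<close>

definition lambda1 :: "(real ^ 'n) set \<Rightarrow> real" where
  "lambda1 \<Omega> = Inf {l. dirichlet_eigenvalue \<Omega> l}"

text \<open>Eigenfunctions are classes modulo null sets; continuity selects the representative (smooth in
  \<open>\<Omega>\<close> by elliptic regularity) for which positivity and maximum points are meant pointwise.\<close>

definition ground_state :: "(real ^ 'n) set \<Rightarrow> (real ^ 'n \<Rightarrow> real) \<Rightarrow> bool" where
  "ground_state \<Omega> \<phi> \<longleftrightarrow>
     dirichlet_eigenfunction \<Omega> (lambda1 \<Omega>) \<phi> \<and> continuous_on \<Omega> \<phi> \<and> (\<forall>x \<in> \<Omega>. \<phi> x > 0)"

end

theory Submission
  imports Defs "HOL-Probability.Distributions"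
begin

text \<open>
  Let \<open>M\<close> be the maximum of the ground state \<open>\<phi>\<close>, attained at \<open>x\<^sub>0\<close>, let \<open>d\<close> be the distance from \<open>x\<^sub>0\<close> to the
  boundary, attained at \<open>y\<close>, and let \<open>\<lambda>\<close> be the eigenvalue. The extension of \<open>\<phi>\<close> by zero satisfies
  \<open>-\<Delta>\<phi> \<le> \<lambda>\<phi>\<close> on the whole space, so \<open>e\<^sup>\<lambda>\<^sup>t\<close> times its average against the heat kernel centred at \<open>x\<^sub>0\<close> is
  nondecreasing in \<open>t\<close>. At \<open>t = 0\<close> it equals \<open>M\<close>. At \<open>t\<close> comparable to \<open>d\<^sup>2\<close> it is at most
  \<open>e\<^sup>\<lambda>\<^sup>t M (1 - c\<alpha>)\<close>, because \<open>\<phi>\<close> vanishes on the proportion \<open>\<alpha>\<close> of the ball of radius \<open>d\<close> around \<open>y\<close>. Hence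
  \<open>\<lambda> d\<^sup>2 \<ge> c\<alpha>\<close>. Conversely, for a ball of radius \<open>\<rho>\<close> in the domain, testing the equation with an explicit bump
  \<open>\<psi>\<close> on that ball with \<open>-\<Delta>\<psi> \<le> C \<rho>\<^sup>-\<^sup>2 \<psi>\<close> gives \<open>\<lambda> \<le> C \<rho>\<^sup>-\<^sup>2\<close>, by positivity of \<open>\<phi>\<close>. Together, \<open>d\<close> is at least a
  constant times \<open>\<rho>\<close>.
\<close>

section \<open>Gradients and smooth functions\<close>

lemma grad_nth:
  assumes "(f has_derivative D) (at x)"
  shows "grad f x $ i = D (axis i 1)"
  using frechet_derivative_at[OF assms] by (simp add: grad_def)

text \<open>\<open>grad\<close> records the Frechet derivative only on the coordinate axes;
  linearity and the expansion of \<open>h\<close> in the standard basis recover all of it. The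
  calculus rules for \<open>grad\<close> below are read off from this form.\<close>

lemma has_derivative_grad:
  assumes "f differentiable (at x)"
  shows "(f has_derivative (\<lambda>h. grad f x \<bullet> h)) (at x)"
proof -
  from assms obtain D where D: "(f has_derivative D) (at x)"
    by (auto simp: differentiable_def)
  then have lin: "linear D"
    using has_derivative_linear by blast
  have "D h = grad f x \<bullet> h" for h
  proof -
    have "D h = D (\<Sum>i\<in>UNIV. (h $ i) *\<^sub>R axis i 1)"
      using basis_expansion[of h] by (simp add: scalar_mult_eq_scaleR)
    also have "\<dots> = (\<Sum>i\<in>UNIV. (h $ i) * D (axis i 1))"
      by (simp add: linear_sum[OF lin] linear_scale[OF lin])
    finally show ?thesis
      by (simp add: inner_vec_def grad_nth[OF D] mult.commute)
  qed
  then have "D = (\<lambda>h. grad f x \<bullet> h)" by auto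
  with D show ?thesis by simp
qed

lemma grad_add:
  assumes "f differentiable (at x)" "g differentiable (at x)"
  shows "grad (\<lambda>x. f x + g x) x = grad f x + grad g x"
  by (simp add: vec_eq_iff grad_nth[OF has_derivative_add[OF assms[THEN has_derivative_grad]]]
      inner_axis)

lemma grad_mult:
  assumes "f differentiable (at x)" "g differentiable (at x)"
  shows "grad (\<lambda>x. f x * g x) x = f x *\<^sub>R grad g x + g x *\<^sub>R grad f x"
  by (simp add: vec_eq_iff grad_nth[OF has_derivative_mult[OF assms[THEN has_derivative_grad]]]
      inner_axis)

lemma grad_compose:
  assumes "f differentiable (at x)" "(h has_real_derivative h') (at (f x))"
  shows "grad (\<lambda>x. h (f x)) x = h' *\<^sub>R grad f x"
  using has_derivative_compose[OF has_derivative_grad[OF assms(1)],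
      of h "\<lambda>t. h' * t"] assms(2)
  by (simp add: vec_eq_iff grad_nth inner_axis has_field_derivative_def)

section \<open>Algebra and composition of functions of class C^k\<close>

lemma Ck_continuous: "Ck k f \<Longrightarrow> continuous_on UNIV f"
  by (cases k) (auto intro: differentiable_imp_continuous_on)

lemma Ck_Suc_imp_Ck: "Ck (Suc k) f \<Longrightarrow> Ck k f"
proof (induction k arbitrary: f)
  case 0
  then show ?case by (auto intro: differentiable_imp_continuous_on)
next
  case (Suc k)
  then show ?case by (metis Ck.simps(2))
qed

lemma differentiable_on_UNIV_iff: "f differentiable_on UNIV \<longleftrightarrow> (\<forall>x. f differentiable (at x))"
  by (simp add: differentiable_on_def)

lemma Ck_Suc_differentiable: "Ck (Suc k) f \<Longrightarrow> f differentiable (at x)"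
  by (simp add: differentiable_on_UNIV_iff)

lemma Ck_const: "Ck k (\<lambda>x. c)"
proof (induction k arbitrary: c)
  case (Suc k)
  have "(\<lambda>x. grad (\<lambda>x. c) x $ i) = (\<lambda>x :: real ^ 'a. 0)" for i
    by (rule ext, rule grad_nth) (rule has_derivative_const)
  with Suc show ?case by simp
qed simp

lemma Ck_nth: "Ck k (\<lambda>x. x $ i)"
proof (cases k)
  case 0
  then show ?thesis by (simp add: continuous_on_component)
next
  case (Suc j)
  have "((\<lambda>x. x $ i) has_derivative (\<lambda>h. h $ i)) (at x)" for x :: "real ^ 'a"
    by (rule bounded_linear_imp_has_derivative[OF bounded_linear_vec_nth])
  then have "grad (\<lambda>x. x $ i) x $ l = axis l 1 $ i" "(\<lambda>x. x $ i) differentiable (at x)"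
    for x :: "real ^ 'a" and l
    by (auto intro: grad_nth simp: differentiable_def)
  then show ?thesis by (simp add: Suc Ck_const differentiable_on_UNIV_iff)
qed

lemma Ck_add: "Ck k f \<Longrightarrow> Ck k g \<Longrightarrow> Ck k (\<lambda>x. f x + g x)"
proof (induction k arbitrary: f g)
  case 0
  then show ?case by (simp add: continuous_on_add)
next
  case (Suc k)
  then have "grad (\<lambda>x. f x + g x) x = grad f x + grad g x" for x
    by (intro grad_add Ck_Suc_differentiable)
  with Suc show ?case by (simp add: differentiable_on_UNIV_iff)
qed

lemma Ck_mult: "Ck k f \<Longrightarrow> Ck k g \<Longrightarrow> Ck k (\<lambda>x. f x * g x)"
proof (induction k arbitrary: f g)
  case 0
  then show ?case by (simp add: continuous_on_mult)
next
  case (Suc k)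
  then have "grad (\<lambda>x. f x * g x) x $ i = f x * grad g x $ i + g x * grad f x $ i" for x i
    by (subst grad_mult) (auto intro: Ck_Suc_differentiable)
  moreover have "Ck k f" "Ck k g" "Ck k (\<lambda>x. grad f x $ i)" "Ck k (\<lambda>x. grad g x $ i)" for i
    using Suc.prems by (auto intro: Ck_Suc_imp_Ck)
  ultimately show ?case using Suc
    by (simp add: differentiable_on_UNIV_iff Ck_add)
qed

lemma Ck_sum: "(\<And>i. i \<in> I \<Longrightarrow> Ck k (f i)) \<Longrightarrow> Ck k (\<lambda>x. \<Sum>i\<in>I. f i x)"
  by (induction I rule: infinite_finite_induct) (auto simp: Ck_const Ck_add)

text \<open>The outer function comes with its whole tower of derivatives \<open>h 0\<close>,
  \<open>h 1\<close>, ..., because the chain rule replaces \<open>h j\<close> by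
  \<open>h (Suc j)\<close> and the induction hypothesis must then apply to that factor.\<close>

lemma Ck_compose:
  fixes h :: "nat \<Rightarrow> real \<Rightarrow> real"
  assumes h: "\<And>j t. (h j has_real_derivative h (Suc j) t) (at t)"
    and f: "Ck k f"
  shows "Ck k (\<lambda>x. h j (f x))"
  using f
proof (induction k arbitrary: j)
  case 0
  have "continuous_on UNIV (h j)"
    by (meson DERIV_isCont continuous_at_imp_continuous_on h)
  then show ?case
    using 0 continuous_on_compose2[of UNIV "h j" UNIV f] by simp
next
  case (Suc k)
  then have diff: "f differentiable (at x)" for x by (auto intro: Ck_Suc_differentiable)
  have "grad (\<lambda>x. h j (f x)) x $ i = h (Suc j) (f x) * grad f x $ i" for x i
    by (subst grad_compose[OF diff h]) simp
  moreover have "(\<lambda>x. h j (f x)) differentiable (at x)" for x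
    using differentiable_chain_at[OF diff, of "h j" x] h[of j "f x"]
    by (auto simp: o_def real_differentiable_def)
  moreover have "Ck k (\<lambda>x. h (Suc j) (f x) * grad f x $ i)" for i
    using Suc.prems Suc.IH[OF Ck_Suc_imp_Ck] by (intro Ck_mult) auto
  ultimately show ?case by (simp add: differentiable_on_UNIV_iff)
qed

text \<open>The functions \<open>p(1/t) e\<^sup>-\<^sup>1\<^sup>/\<^sup>t\<close>, extended by \<open>0\<close> to \<open>t \<le> 0\<close>, are closed under differentiation; this
  makes \<open>e\<^sup>-\<^sup>1\<^sup>/\<^sup>t\<close> smooth.\<close>

definition flat_poly :: "real poly \<Rightarrow> real \<Rightarrow> real" where
  "flat_poly p t = (if t > 0 then poly p (1 / t) * exp (- 1 / t) else 0)"

text \<open>With s = 1/t one has d/dt = -s^2 d/ds, so p(s) e^(-s) has the derivative s^2 (p(s) -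
  p'(s)) e^(-s). The factor \<open>[:0, 0, 1:]\<close> is s^2.\<close>

definition flat_step :: "real poly \<Rightarrow> real poly" where
  "flat_step p = [:0, 0, 1:] * (p - pderiv p)"

lemma poly_div_exp_tendsto_0: "((\<lambda>s. poly p s * exp (- s)) \<longlongrightarrow> (0::real)) at_top"
proof -
  have "((\<lambda>s. \<Sum>i\<le>degree p. coeff p i * (s ^ i / exp s)) \<longlongrightarrow> (\<Sum>i\<le>degree p. coeff p i * 0)) at_top"
    by (intro tendsto_intros tendsto_power_div_exp_0)
  then show ?thesis
    by (simp add: poly_altdef sum_distrib_right exp_minus divide_inverse mult.assoc)
qed

lemma flat_poly_has_derivative: "(flat_poly p has_real_derivative flat_poly (flat_step p) t) (at t)"
proof (cases t "0::real" rule: linorder_cases)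
  case less
  have "((\<lambda>_. 0) has_real_derivative 0) (at t)" by simp
  then show ?thesis
    by (rule has_field_derivative_transform_within_open[where S="{..<0}", THEN DERIV_cong])
      (use less in \<open>auto simp: flat_poly_def\<close>)
next
  case greater
  have "((\<lambda>t. poly p (1 / t) * exp (- 1 / t)) has_real_derivative flat_poly (flat_step p) t) (at t)"
    using greater
    by (auto intro!: derivative_eq_intros DERIV_chain'[OF _ poly_DERIV]
        simp: flat_poly_def flat_step_def field_simps power2_eq_square)
  then show ?thesis
    by (rule has_field_derivative_transform_within_open[where S="{0<..}"])
      (use greater in \<open>auto simp: flat_poly_def\<close>)
next
  case equal
  have "((\<lambda>h. flat_poly p h / h) \<longlongrightarrow> 0) (at 0)"
  proof (rule filterlim_split_at)
    have "\<forall>\<^sub>F h in at_left 0. flat_poly p h / h = 0"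
      by (auto simp: eventually_at_filter flat_poly_def)
    then show "((\<lambda>h. flat_poly p h / h) \<longlongrightarrow> 0) (at_left 0)"
      by (rule tendsto_eventually)
    \<comment> \<open>Dividing by \<open>h\<close> multiplies by the variable s = 1/h, which turns
      \<open>p\<close> into \<open>pCons 0 p\<close>. As \<open>h\<close> decreases to 0, s tends to
      infinity and the exponential beats the polynomial.\<close>
    have "((\<lambda>h. poly (pCons 0 p) (inverse h) * exp (- inverse h)) \<longlongrightarrow> 0) (at_right (0::real))"
      by (rule filterlim_compose[OF poly_div_exp_tendsto_0 filterlim_inverse_at_top_right])
    moreover have "\<forall>\<^sub>F h in at_right 0.
        poly (pCons 0 p) (inverse h) * exp (- inverse h) = flat_poly p h / h"
      by (auto simp: eventually_at_filter flat_poly_def field_simps)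
    ultimately show "((\<lambda>h. flat_poly p h / h) \<longlongrightarrow> 0) (at_right 0)"
      by (rule Lim_transform_eventually)
  qed
  then show ?thesis
    by (simp add: equal DERIV_def flat_poly_def)
qed

definition flat :: "real \<Rightarrow> real" where
  "flat = flat_poly 1"

text \<open>The iterates of \<open>flat_step\<close> on the polynomial 1 form the tower of
  derivatives required by \<open>Ck_compose\<close>.\<close>

lemma Ck_flat_compose: "Ck k f \<Longrightarrow> Ck k (\<lambda>x. flat (f x))"
  using Ck_compose[of "\<lambda>j. flat_poly ((flat_step ^^ j) 1)" k f 0]
  by (simp add: flat_poly_has_derivative flat_def)

lemma Ck_exp_compose: "Ck k f \<Longrightarrow> Ck k (\<lambda>x. exp (f x))"
  using Ck_compose[of "\<lambda>_. exp" k f] by (simp add: DERIV_exp)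

lemma flat_pos_iff: "flat t > 0 \<longleftrightarrow> t > 0"
  by (simp add: flat_def flat_poly_def)

section \<open>Square-integrable functions and integration by parts\<close>

text \<open>The integral of \<open>(t * a x + b x)^2\<close> is a quadratic polynomial in
  \<open>t\<close> that is nowhere negative, and this bounds its middle coefficient.\<close>

lemma Cauchy_Schwarz_integral:
  fixes a b :: "'a \<Rightarrow> real"
  assumes [measurable]: "a \<in> borel_measurable M" "b \<in> borel_measurable M"
    and a: "integrable M (\<lambda>x. (a x)\<^sup>2)" and b: "integrable M (\<lambda>x. (b x)\<^sup>2)"
  shows "integrable M (\<lambda>x. a x * b x)"
    and "\<bar>\<integral>x. a x * b x \<partial>M\<bar> \<le> sqrt (\<integral>x. (a x)\<^sup>2 \<partial>M) * sqrt (\<integral>x. (b x)\<^sup>2 \<partial>M)"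
proof -
  have "\<bar>a x * b x\<bar> \<le> (a x)\<^sup>2 + (b x)\<^sup>2" for x
  proof -
    have "2 * \<bar>a x\<bar> * \<bar>b x\<bar> \<le> (a x)\<^sup>2 + (b x)\<^sup>2"
      using sum_squares_bound[of "\<bar>a x\<bar>" "\<bar>b x\<bar>"] by simp
    moreover have "0 \<le> \<bar>a x\<bar> * \<bar>b x\<bar>" by simp
    ultimately show ?thesis unfolding abs_mult by linarith
  qed
  then show ab: "integrable M (\<lambda>x. a x * b x)"
    by (intro Bochner_Integration.integrable_bound[OF Bochner_Integration.integrable_add[OF a b]])
      auto
  define A B P where "A = (\<integral>x. (a x)\<^sup>2 \<partial>M)" and "B = (\<integral>x. (b x)\<^sup>2 \<partial>M)"
    and "P = (\<integral>x. a x * b x \<partial>M)"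
  have q: "0 \<le> t\<^sup>2 * A + 2 * t * P + B" for t
  proof -
    have "0 \<le> (\<integral>x. (t * a x + b x)\<^sup>2 \<partial>M)" by simp
    also have "\<dots> = (\<integral>x. t\<^sup>2 * (a x)\<^sup>2 + 2 * t * (a x * b x) + (b x)\<^sup>2 \<partial>M)"
      by (intro Bochner_Integration.integral_cong) (auto simp: power2_eq_square algebra_simps)
    also have "\<dots> = t\<^sup>2 * A + 2 * t * P + B"
      using a b ab by (simp add: A_def B_def P_def)
    finally show ?thesis .
  qed
  have nn: "A \<ge> 0" "B \<ge> 0" by (simp_all add: A_def B_def)
  have "P\<^sup>2 \<le> A * B"
  proof (cases "A = 0")
    case True
    have "P = 0"
    proof (rule ccontr)
      assume "P \<noteq> 0"
      \<comment> \<open>For \<open>A = 0\<close> the polynomial is affine with slope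
        \<open>2 * P\<close>; at this \<open>t\<close> it would take the value -1.\<close>
      then show False using q[of "- (B + 1) / (2 * P)"] True by (simp add: field_simps)
    qed
    with True show ?thesis by simp
  next
    case False
    with nn have "A > 0" by simp
    \<comment> \<open>\<open>- P / A\<close> is the minimiser of the quadratic.\<close>
    then show ?thesis using q[of "- P / A"]
      by (simp add: field_simps power2_eq_square)
  qed
  then have "sqrt (P\<^sup>2) \<le> sqrt (A * B)" by (rule real_sqrt_le_mono)
  then show "\<bar>P\<bar> \<le> sqrt A * sqrt B" by (simp add: real_sqrt_mult)
qed

lemma square_integrable_diff:
  fixes f g :: "'a \<Rightarrow> 'b::euclidean_space"
  assumes [measurable]: "f \<in> borel_measurable M" "g \<in> borel_measurable M"
    and f: "integrable M (\<lambda>x. (norm (f x))\<^sup>2)" and g: "integrable M (\<lambda>x. (norm (g x))\<^sup>2)"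
  shows "integrable M (\<lambda>x. (norm (f x - g x))\<^sup>2)"
proof (rule Bochner_Integration.integrable_bound)
  show "integrable M (\<lambda>x. 2 * (norm (f x))\<^sup>2 + 2 * (norm (g x))\<^sup>2)"
    using f g by simp
  show "AE x in M. norm ((norm (f x - g x))\<^sup>2) \<le> norm (2 * (norm (f x))\<^sup>2 + 2 * (norm (g x))\<^sup>2)"
  proof (rule AE_I2)
    fix x
    have "(norm (f x - g x))\<^sup>2 \<le> (norm (f x) + norm (g x))\<^sup>2"
      by (simp add: norm_triangle_ineq4 power_mono)
    also have "\<dots> \<le> 2 * (norm (f x))\<^sup>2 + 2 * (norm (g x))\<^sup>2"
      using sum_squares_bound[of "norm (f x)" "norm (g x)"] by (simp add: power2_sum)
    finally show "norm ((norm (f x - g x))\<^sup>2) \<le> norm (2 * (norm (f x))\<^sup>2 + 2 * (norm (g x))\<^sup>2)"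
      by simp
  qed
qed measurable

lemma integrable_inner:
  fixes f h :: "'a \<Rightarrow> 'b::euclidean_space"
  assumes [measurable]: "f \<in> borel_measurable M" "h \<in> borel_measurable M"
    and f: "integrable M (\<lambda>x. (norm (f x))\<^sup>2)" and h: "integrable M (\<lambda>x. (norm (h x))\<^sup>2)"
  shows "integrable M (\<lambda>x. f x \<bullet> h x)"
  by (rule Bochner_Integration.integrable_bound[OF Cauchy_Schwarz_integral(1)[of "\<lambda>x. norm (f x)" M "\<lambda>x. norm (h x)"]])
    (use f h in \<open>auto simp: Cauchy_Schwarz_ineq2\<close>)

text \<open>By Cauchy-Schwarz. The product of norms, rather than an inner product, also serves as
  the error term in \<open>weak_solution_flat_cutoff\<close>, where a variable weight has been
  estimated away.\<close>

lemma L2_norm_mult_tendsto_0: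
  fixes F :: "nat \<Rightarrow> 'a \<Rightarrow> 'b::euclidean_space" and h :: "'a \<Rightarrow> 'c::euclidean_space"
  assumes [measurable]: "\<And>k. F k \<in> borel_measurable M" "f \<in> borel_measurable M" "h \<in> borel_measurable M"
    and F: "\<And>k. integrable M (\<lambda>x. (norm (F k x))\<^sup>2)" and f: "integrable M (\<lambda>x. (norm (f x))\<^sup>2)"
    and h: "integrable M (\<lambda>x. (norm (h x))\<^sup>2)"
    and lim: "(\<lambda>k. \<integral>x. (norm (F k x - f x))\<^sup>2 \<partial>M) \<longlonglongrightarrow> 0"
  shows "(\<lambda>k. \<integral>x. norm (F k x - f x) * norm (h x) \<partial>M) \<longlonglongrightarrow> 0"
proof (rule tendsto_rabs_zero_cancel, rule tendsto_sandwich[of "\<lambda>_. 0"])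
  show "(\<lambda>k. sqrt (\<integral>x. (norm (F k x - f x))\<^sup>2 \<partial>M) * sqrt (\<integral>x. (norm (h x))\<^sup>2 \<partial>M)) \<longlonglongrightarrow> 0"
    using tendsto_mult_left_zero[OF tendsto_real_sqrt[OF lim, simplified]] by simp
  show "\<forall>\<^sub>F k in sequentially. \<bar>\<integral>x. norm (F k x - f x) * norm (h x) \<partial>M\<bar>
      \<le> sqrt (\<integral>x. (norm (F k x - f x))\<^sup>2 \<partial>M) * sqrt (\<integral>x. (norm (h x))\<^sup>2 \<partial>M)"
    by (intro always_eventually allI Cauchy_Schwarz_integral(2) square_integrable_diff F f h) measurable
qed auto

lemma L2_inner_tendsto:
  fixes F :: "nat \<Rightarrow> 'a \<Rightarrow> 'b::euclidean_space"
  assumes [measurable]: "\<And>k. F k \<in> borel_measurable M" "f \<in> borel_measurable M" "h \<in> borel_measurable M"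
    and F: "\<And>k. integrable M (\<lambda>x. (norm (F k x))\<^sup>2)" and f: "integrable M (\<lambda>x. (norm (f x))\<^sup>2)"
    and h: "integrable M (\<lambda>x. (norm (h x))\<^sup>2)"
    and lim: "(\<lambda>k. \<integral>x. (norm (F k x - f x))\<^sup>2 \<partial>M) \<longlonglongrightarrow> 0"
  shows "(\<lambda>k. \<integral>x. F k x \<bullet> h x \<partial>M) \<longlonglongrightarrow> (\<integral>x. f x \<bullet> h x \<partial>M)"
proof (rule LIM_zero_cancel, rule tendsto_rabs_zero_cancel, rule tendsto_sandwich[of "\<lambda>_. 0"])
  show "(\<lambda>k. \<integral>x. norm (F k x - f x) * norm (h x) \<partial>M) \<longlonglongrightarrow> 0"
    by (rule L2_norm_mult_tendsto_0) (use assms in auto)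
  show "\<forall>\<^sub>F k in sequentially. \<bar>(\<integral>x. F k x \<bullet> h x \<partial>M) - (\<integral>x. f x \<bullet> h x \<partial>M)\<bar>
      \<le> (\<integral>x. norm (F k x - f x) * norm (h x) \<partial>M)"
  proof (intro always_eventually allI)
    fix k
    have "(\<integral>x. F k x \<bullet> h x \<partial>M) - (\<integral>x. f x \<bullet> h x \<partial>M) = (\<integral>x. (F k x - f x) \<bullet> h x \<partial>M)"
      by (simp add: integrable_inner F f h inner_diff_left)
    also have "\<bar>\<dots>\<bar> \<le> (\<integral>x. \<bar>(F k x - f x) \<bullet> h x\<bar> \<partial>M)"
      by (rule integral_abs_bound)
    also have "\<dots> \<le> (\<integral>x. norm (F k x - f x) * norm (h x) \<partial>M)"
    proof (intro integral_mono)
      show "integrable M (\<lambda>x. \<bar>(F k x - f x) \<bullet> h x\<bar>)"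
        by (intro integrable_abs integrable_inner square_integrable_diff F f h) measurable
      show "integrable M (\<lambda>x. norm (F k x - f x) * norm (h x))"
        by (intro Cauchy_Schwarz_integral square_integrable_diff F f h) measurable
    qed (rule Cauchy_Schwarz_ineq2)
    finally show "\<bar>(\<integral>x. F k x \<bullet> h x \<partial>M) - (\<integral>x. f x \<bullet> h x \<partial>M)\<bar>
      \<le> (\<integral>x. norm (F k x - f x) * norm (h x) \<partial>M)" .
  qed
qed auto

text \<open>By translation invariance the difference quotients of \<open>f\<close> have integral \<open>0\<close>.\<close>

lemma integral_grad_eq_0:
  fixes f :: "real ^ 'n \<Rightarrow> real"
  assumes diff: "\<And>x. f differentiable (at x)"
    and cont: "continuous_on UNIV (\<lambda>x. grad f x $ i)"
    and supp: "\<And>x. norm x > R \<Longrightarrow> f x = 0"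
  shows "(\<integral>x. grad f x $ i \<partial>lborel) = 0"
proof -
  have cf: "continuous_on UNIV f"
    by (simp add: continuous_at_imp_continuous_on diff differentiable_imp_continuous_within)
  have [measurable]: "f \<in> borel_measurable borel" "(\<lambda>x. grad f x $ i) \<in> borel_measurable borel"
    using cf cont by (auto intro: borel_measurable_continuous_onI)
  have intf: "integrable lborel f"
  proof -
    have "integrable lborel (\<lambda>x. indicator (cball 0 R) x *\<^sub>R f x)"
      by (rule borel_integrable_compact) (auto intro: continuous_on_subset[OF cf])
    also have "(\<lambda>x. indicator (cball 0 R) x *\<^sub>R f x) = f"
      using supp by (auto simp: indicator_def fun_eq_iff not_le)
    finally show ?thesis .
  qed
  have "compact ((\<lambda>x. grad f x $ i) ` cball 0 (R + 2))"
    by (intro compact_continuous_image continuous_on_subset[OF cont]) auto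
  then have "bounded ((\<lambda>x. grad f x $ i) ` cball 0 (R + 2))"
    by (rule compact_imp_bounded)
  then obtain B where "\<forall>y\<in>(\<lambda>x. grad f x $ i) ` cball 0 (R + 2). norm y \<le> B"
    unfolding bounded_iff by blast
  then have B: "\<bar>grad f x $ i\<bar> \<le> B" if "norm x \<le> R + 2" for x
    using that by simp
  define e :: "real ^ 'n" where "e = axis i 1"
  have ne: "norm e = 1" by (simp add: e_def)
  define h where "h k = inverse (real (Suc k))" for k
  have h: "0 < h k" "h k \<le> 1" for k by (auto simp: h_def field_simps)
  define q where "q k x = (f (h k *\<^sub>R e + x) - f x) / h k" for k x
  \<comment> \<open>This supplies the integrable majorant. For norm at most \<open>R + 1\<close> the
    mean value theorem gives a point at most 1 farther out, hence the bound \<open>B\<close> taken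
    on radius \<open>R + 2\<close>; beyond \<open>R + 1\<close> both values of \<open>f\<close>
    vanish, since the shift has length at most 1.\<close>
  have qbound: "norm (q k x) \<le> \<bar>B\<bar> * indicator (cball 0 (R + 1)) x" for k x
  proof (cases "norm x \<le> R + 1")
    case True
    have "((\<lambda>t. f (t *\<^sub>R e + x)) has_real_derivative grad f (t *\<^sub>R e + x) $ i) (at t)" for t
    proof -
      have "((\<lambda>t. t *\<^sub>R e + x) has_derivative (\<lambda>s. s *\<^sub>R e)) (at t)"
        by (auto intro!: derivative_eq_intros)
      from has_derivative_compose[OF this has_derivative_grad[OF diff]]
      show ?thesis
        by (simp add: has_field_derivative_def e_def inner_axis mult.commute[of _ "grad f _ $ i"])
    qed
    from MVT2[OF h(1)[of k], OF this]
    obtain z where z: "0 < z" "z < h k"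
      "f (h k *\<^sub>R e + x) - f (0 *\<^sub>R e + x) = (h k - 0) * grad f (z *\<^sub>R e + x) $ i"
      by blast
    then have "q k x = grad f (z *\<^sub>R e + x) $ i"
      using h(1)[of k] by (simp add: q_def)
    moreover have "norm (z *\<^sub>R e + x) \<le> R + 2"
      using norm_triangle_ineq[of "z *\<^sub>R e" x] True z h(2)[of k] ne by simp
    ultimately have "\<bar>q k x\<bar> \<le> B" using B by simp
    then show ?thesis using True by simp
  next
    case False
    then have "norm (h k *\<^sub>R e + x) > R"
      using norm_triangle_ineq2[of x "- (h k *\<^sub>R e)"] h[of k] ne by (simp add: add.commute)
    with False show ?thesis by (simp add: q_def supp)
  qed
  have q0: "(\<integral>x. q k x \<partial>lborel) = 0" for k
  proof -
    have "(\<integral>x. f (h k *\<^sub>R e + x) \<partial>lborel) = (\<integral>x. f x \<partial>distr lborel borel ((+) (h k *\<^sub>R e)))"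
      by (simp add: integral_distr)
    also have "\<dots> = (\<integral>x. f x \<partial>lborel)" by (simp add: lborel_distr_plus)
    finally have "(\<integral>x. f (h k *\<^sub>R e + x) \<partial>lborel) = (\<integral>x. f x \<partial>lborel)" .
    moreover have "integrable (distr lborel borel ((+) (h k *\<^sub>R e))) f"
      by (simp add: lborel_distr_plus intf)
    then have "integrable lborel (\<lambda>x. f (h k *\<^sub>R e + x))"
      by (subst (asm) integrable_distr_eq) auto
    ultimately show ?thesis by (simp add: q_def intf)
  qed
  have h0: "h \<longlonglongrightarrow> 0"
    unfolding h_def by (rule LIMSEQ_inverse_real_of_nat)
  have lim: "(\<lambda>k. q k x) \<longlonglongrightarrow> grad f x $ i" for x
  proof -
    have "((\<lambda>t. t *\<^sub>R e + x) has_derivative (\<lambda>s. s *\<^sub>R e)) (at 0)"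
      by (auto intro!: derivative_eq_intros)
    from has_derivative_compose[OF this, of f "\<lambda>v. grad f x \<bullet> v"] has_derivative_grad[OF diff, of x]
    have "((\<lambda>t. f (t *\<^sub>R e + x)) has_real_derivative grad f x $ i) (at 0)"
      by (simp add: has_field_derivative_def e_def inner_axis mult.commute[of _ "grad f _ $ i"])
    then have "((\<lambda>t. (f (t *\<^sub>R e + x) - f x) / t) \<longlongrightarrow> grad f x $ i) (at 0)"
      by (simp add: DERIV_def)
    moreover have "filterlim h (at 0) sequentially"
      using h0 h(1) by (auto simp: filterlim_at intro!: always_eventually) (metis less_irrefl)
    ultimately show ?thesis
      unfolding q_def by (rule filterlim_compose)
  qed
  have "(\<lambda>k. \<integral>x. q k x \<partial>lborel) \<longlonglongrightarrow> (\<integral>x. grad f x $ i \<partial>lborel)"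
  proof (rule integral_dominated_convergence)
    have "integrable lborel (indicator (cball (0 :: real ^ 'n) (R + 1)) :: _ \<Rightarrow> real)"
      using emeasure_lborel_cball_finite[of "0 :: real ^ 'n" "R + 1"]
      by (intro integrable_real_indicator) auto
    then show "integrable lborel (\<lambda>x :: real ^ 'n. \<bar>B\<bar> * indicator (cball 0 (R + 1)) x :: real)"
      by simp
    show "q k \<in> borel_measurable lborel" for k unfolding q_def by measurable
    show "AE x in lborel. (\<lambda>k. q k x) \<longlonglongrightarrow> grad f x $ i"
      by (rule AE_I2) (rule lim)
    show "AE x in lborel. norm (q k x) \<le> \<bar>B\<bar> * indicator (cball 0 (R + 1)) x" for k
      by (rule AE_I2) (rule qbound)
  qed simp
  then show ?thesis
    by (simp add: q0 LIMSEQ_const_iff)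
qed

section \<open>The Laplacian and Green's identity\<close>

definition laplacian :: "(real ^ 'n \<Rightarrow> real) \<Rightarrow> real ^ 'n \<Rightarrow> real" where
  "laplacian f x = (\<Sum>i\<in>UNIV. grad (\<lambda>y. grad f y $ i) x $ i)"

definition smooth :: "(real ^ 'n \<Rightarrow> real) \<Rightarrow> bool" where
  "smooth f \<longleftrightarrow> (\<forall>k. Ck k f)"

lemma smooth_add: "smooth f \<Longrightarrow> smooth g \<Longrightarrow> smooth (\<lambda>x. f x + g x)"
  by (simp add: smooth_def Ck_add del: Ck.simps)

lemma smooth_const: "smooth (\<lambda>x. c)"
  by (simp add: smooth_def Ck_const del: Ck.simps)

lemma smooth_nth: "smooth (\<lambda>x. x $ i)"
  by (simp add: smooth_def Ck_nth del: Ck.simps)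

lemma smooth_flat: "smooth f \<Longrightarrow> smooth (\<lambda>x. flat (f x))"
  by (simp add: smooth_def Ck_flat_compose del: Ck.simps)

lemma smooth_exp: "smooth f \<Longrightarrow> smooth (\<lambda>x. exp (f x))"
  by (simp add: smooth_def Ck_exp_compose del: Ck.simps)

lemma smooth_mult: "smooth f \<Longrightarrow> smooth g \<Longrightarrow> smooth (\<lambda>x. f x * g x)"
  by (simp add: smooth_def Ck_mult del: Ck.simps)

lemma smooth_sum: "(\<And>i. i \<in> I \<Longrightarrow> smooth (f i)) \<Longrightarrow> smooth (\<lambda>x. \<Sum>i\<in>I. f i x)"
  by (simp add: smooth_def Ck_sum del: Ck.simps)

lemma smooth_partial: "smooth f \<Longrightarrow> smooth (\<lambda>x. grad f x $ i)"
  unfolding smooth_def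
proof
  fix k
  assume "\<forall>k. Ck k f"
  then have "Ck (Suc k) f" by blast
  then show "Ck k (\<lambda>x. grad f x $ i)" by simp
qed

lemma smooth_differentiable: "smooth f \<Longrightarrow> f differentiable (at x)"
  using Ck_Suc_differentiable smooth_def by blast

lemma smooth_continuous: "smooth f \<Longrightarrow> continuous_on S f"
  unfolding smooth_def by (blast intro: Ck_continuous continuous_on_subset)

lemma smooth_continuous_grad: "smooth f \<Longrightarrow> continuous_on S (grad f)"
  using continuous_on_vec_lambda[of S "\<lambda>i x. grad f x $ i"]
  by (simp add: smooth_continuous smooth_partial)

lemma smooth_laplacian: "smooth f \<Longrightarrow> smooth (laplacian f)"
  unfolding laplacian_def[abs_def] by (intro smooth_sum smooth_partial)

lemma grad_eq_0_outside_support: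
  assumes "x \<notin> closure {x. f x \<noteq> 0}"
  shows "grad f x = 0"
proof -
  have "((\<lambda>_. 0) has_derivative (\<lambda>_. 0)) (at x)" by simp
  then have "(f has_derivative (\<lambda>_. 0)) (at x)"
  proof (rule has_derivative_transform_within_open[where s="- closure {x. f x \<noteq> 0}"])
    show "0 = f y" if "y \<in> - closure {x. f x \<noteq> 0}" for y
      using that closure_subset[of "{x. f x \<noteq> 0}"] by auto
  qed (use assms in \<open>simp_all add: open_Compl\<close>)
  then show ?thesis by (simp add: vec_eq_iff grad_nth)
qed

text \<open>Eigenfunctions are defined through \<open>lebesgue_on\<close>, while translation and
  scaling of integrals are carried out over \<open>lborel\<close>. This passes from one to the other
  for Borel functions vanishing off \<Omega>.\<close>

lemma integral_lebesgue_on_eq_lborel: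
  fixes f :: "real ^ 'n \<Rightarrow> real"
  assumes "open \<Omega>" and [measurable]: "f \<in> borel_measurable borel" and "\<And>x. x \<notin> \<Omega> \<Longrightarrow> f x = 0"
  shows "(\<integral>x. f x \<partial>lebesgue_on \<Omega>) = (\<integral>x. f x \<partial>lborel)"
proof -
  have "(\<integral>x. f x \<partial>lebesgue_on \<Omega>) = (\<integral>x. indicator \<Omega> x *\<^sub>R f x \<partial>lebesgue)"
    using assms by (intro integral_restrict_space) auto
  also have "(\<lambda>x. indicator \<Omega> x *\<^sub>R f x) = f"
    using assms(3) by (auto simp: fun_eq_iff indicator_def)
  finally show ?thesis by (simp add: integral_completion)
qed

lemma finite_measure_lebesgue_on_bounded:
  fixes \<Omega> :: "'a::euclidean_space set"
  assumes "open \<Omega>" "bounded \<Omega>"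
  shows "finite_measure (lebesgue_on \<Omega>)"
  by (rule finite_measure_lebesgue_on) (use assms lmeasurable_open in auto)

lemma continuous_bounded_on:
  fixes f :: "'a::euclidean_space \<Rightarrow> 'b::euclidean_space"
  assumes "bounded \<Omega>" "continuous_on UNIV f"
  obtains B where "B > 0" "\<And>x. x \<in> \<Omega> \<Longrightarrow> norm (f x) \<le> B"
proof -
  have "compact (f ` closure \<Omega>)"
    using assms by (intro compact_continuous_image) (auto intro: continuous_on_subset simp: compact_closure)
  then obtain B where "B > 0" "\<forall>y\<in>f ` closure \<Omega>. norm y \<le> B"
    using compact_imp_bounded bounded_pos by blast
  then show ?thesis using that closure_subset[of \<Omega>] by blast
qed

lemma continuous_measurable_lebesgue_on:
  fixes f :: "'a::euclidean_space \<Rightarrow> 'b::euclidean_space"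
  assumes "open \<Omega>" "continuous_on \<Omega> f"
  shows "f \<in> borel_measurable (lebesgue_on \<Omega>)"
  using assms by (intro continuous_imp_measurable_on_sets_lebesgue) auto

lemma integrable_continuous_bounded:
  fixes f :: "'a::euclidean_space \<Rightarrow> 'b::euclidean_space"
  assumes "open \<Omega>" "bounded \<Omega>" "continuous_on UNIV f"
  shows "integrable (lebesgue_on \<Omega>) f"
proof -
  interpret finite_measure "lebesgue_on \<Omega>"
    using assms by (intro finite_measure_lebesgue_on_bounded)
  obtain B where "\<And>x. x \<in> \<Omega> \<Longrightarrow> norm (f x) \<le> B"
    using continuous_bounded_on[OF assms(2,3)] by metis
  then show ?thesis
    by (intro integrable_const_bound[of _ B] AE_I2 continuous_measurable_lebesgue_on)
      (use assms in \<open>auto intro: continuous_on_subset\<close>)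
qed

lemma L2_on_continuous:
  fixes f :: "real ^ 'n \<Rightarrow> 'b::euclidean_space"
  assumes "open \<Omega>" "bounded \<Omega>" "continuous_on UNIV f"
  shows "L2_on \<Omega> f"
  unfolding L2_on_def using assms
  by (auto intro!: continuous_measurable_lebesgue_on integrable_continuous_bounded continuous_intros
      intro: continuous_on_subset)

lemma L2_on_inner_tendsto:
  assumes "\<And>k. L2_on \<Omega> (F k)" "L2_on \<Omega> f" "L2_on \<Omega> h" "L2_tendsto \<Omega> F f"
  shows "(\<lambda>k. \<integral>x. F k x \<bullet> h x \<partial>lebesgue_on \<Omega>) \<longlonglongrightarrow> (\<integral>x. f x \<bullet> h x \<partial>lebesgue_on \<Omega>)"
  using assms unfolding L2_on_def L2_tendsto_def by (intro L2_inner_tendsto) blast+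

lemma test_function_smooth: "test_function \<Omega> \<psi> \<Longrightarrow> smooth \<psi>"
  by (simp add: test_function_def smooth_def)

text \<open>The products \<open>\<psi> x * grad \<eta> x $ i\<close> have compact support, so their
  \<open>i\<close>-th partial derivatives integrate to 0; the sum over \<open>i\<close> is the
  divergence theorem. The support of \<psi> removes the boundary term, whatever the values of \<eta>
  there.\<close>

lemma test_function_integral_by_parts:
  fixes \<Omega> :: "(real ^ 'n) set"
  assumes "open \<Omega>" "bounded \<Omega>" and \<psi>: "test_function \<Omega> \<psi>" and \<eta>: "smooth \<eta>"
  shows "(\<integral>x. grad \<psi> x \<bullet> grad \<eta> x \<partial>lebesgue_on \<Omega>) = - (\<integral>x. \<psi> x * laplacian \<eta> x \<partial>lebesgue_on \<Omega>)"
proof -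
  have s\<psi>: "smooth \<psi>" using \<psi> by (rule test_function_smooth)
  have supp: "closure {x. \<psi> x \<noteq> 0} \<subseteq> \<Omega>" and "compact (closure {x. \<psi> x \<noteq> 0})"
    using \<psi> by (auto simp: test_function_def)
  then obtain R where R: "\<And>x. x \<in> closure {x. \<psi> x \<noteq> 0} \<Longrightarrow> norm x \<le> R"
    using compact_imp_bounded bounded_iff by metis
  define f where "f i x = \<psi> x * grad \<eta> x $ i" for i x
  have sf: "smooth (f i)" for i
    unfolding f_def[abs_def] by (intro smooth_mult smooth_partial s\<psi> \<eta>)
  have grad_f: "grad (f i) x $ i = \<psi> x * grad (\<lambda>y. grad \<eta> y $ i) x $ i + grad \<psi> x $ i * grad \<eta> x $ i" for i x
    unfolding f_def
    by (subst grad_mult) (auto intro: smooth_differentiable s\<psi> smooth_partial \<eta>)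
  have "f i x = 0" if "norm x > R" for i x
    using R[of x] that closure_subset[of "{x. \<psi> x \<noteq> 0}"] by (auto simp: f_def)
  then have "(\<integral>x. grad (f i) x $ i \<partial>lborel) = 0" for i
    by (intro integral_grad_eq_0) (auto intro: smooth_differentiable sf smooth_continuous smooth_partial)
  moreover have "(\<integral>x. grad (f i) x $ i \<partial>lebesgue_on \<Omega>) = (\<integral>x. grad (f i) x $ i \<partial>lborel)" for i
  proof (rule integral_lebesgue_on_eq_lborel)
    show "grad (f i) x $ i = 0" if "x \<notin> \<Omega>" for x
    proof -
      have "x \<notin> closure {x. \<psi> x \<noteq> 0}" using that supp by blast
      then show ?thesis
        using grad_eq_0_outside_support[of x \<psi>] closure_subset[of "{x. \<psi> x \<noteq> 0}"]
        by (auto simp: grad_f)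
    qed
    show "(\<lambda>x. grad (f i) x $ i) \<in> borel_measurable borel"
      by (intro borel_measurable_continuous_onI smooth_continuous smooth_partial sf)
  qed fact
  ultimately have 0: "(\<integral>x. grad (f i) x $ i \<partial>lebesgue_on \<Omega>) = 0" for i by simp
  have int: "integrable (lebesgue_on \<Omega>) (\<lambda>x. grad (f i) x $ i)" for i
    using assms by (intro integrable_continuous_bounded smooth_continuous smooth_partial sf)
  have "(\<integral>x. \<psi> x * laplacian \<eta> x + grad \<psi> x \<bullet> grad \<eta> x \<partial>lebesgue_on \<Omega>)
      = (\<integral>x. (\<Sum>i\<in>UNIV. grad (f i) x $ i) \<partial>lebesgue_on \<Omega>)"
    by (simp add: grad_f laplacian_def inner_vec_def sum.distrib sum_distrib_left)
  also have "\<dots> = 0" by (simp add: 0 int)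
  finally have "(\<integral>x. \<psi> x * laplacian \<eta> x + grad \<psi> x \<bullet> grad \<eta> x \<partial>lebesgue_on \<Omega>) = 0" .
  moreover have "integrable (lebesgue_on \<Omega>) (\<lambda>x. \<psi> x * laplacian \<eta> x)"
    by (rule integrable_continuous_bounded[OF assms(1,2)] smooth_continuous smooth_mult
        smooth_laplacian s\<psi> \<eta>)+
  moreover have "integrable (lebesgue_on \<Omega>) (\<lambda>x. grad \<psi> x \<bullet> grad \<eta> x)"
    by (rule integrable_continuous_bounded[OF assms(1,2)] continuous_on_inner
        smooth_continuous_grad s\<psi> \<eta>)+
  ultimately show ?thesis by simp
qed

text \<open>Both sides of Green's identity for the approximating test functions are L^2 pairings
  with fixed functions that are continuous, hence square-integrable on the bounded set, so they pass
  to the limit. This is where the zero boundary values of \<open>u\<close> enter.\<close>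

lemma H10_integral_by_parts:
  fixes \<Omega> :: "(real ^ 'n) set"
  assumes "open \<Omega>" "bounded \<Omega>" and u: "H10 \<Omega> u g" and \<eta>: "smooth \<eta>"
  shows "(\<integral>x. g x \<bullet> grad \<eta> x \<partial>lebesgue_on \<Omega>) = - (\<integral>x. u x * laplacian \<eta> x \<partial>lebesgue_on \<Omega>)"
proof -
  from u obtain \<psi> where \<psi>: "\<And>k::nat. test_function \<Omega> (\<psi> k)"
    and lim: "L2_tendsto \<Omega> \<psi> u" "L2_tendsto \<Omega> (\<lambda>k. grad (\<psi> k)) g" and L2: "L2_on \<Omega> u" "L2_on \<Omega> g"
    unfolding H10_def by blast
  have "L2_on \<Omega> (\<psi> k)" "L2_on \<Omega> (grad (\<psi> k))" for k
    by (rule L2_on_continuous[OF assms(1,2)] smooth_continuous smooth_continuous_grad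
        test_function_smooth \<psi>)+
  moreover have "L2_on \<Omega> (grad \<eta>)" "L2_on \<Omega> (laplacian \<eta>)"
    by (rule L2_on_continuous[OF assms(1,2)] smooth_continuous smooth_continuous_grad
        smooth_laplacian \<eta>)+
  ultimately have grad: "(\<lambda>k. \<integral>x. grad (\<psi> k) x \<bullet> grad \<eta> x \<partial>lebesgue_on \<Omega>)
      \<longlonglongrightarrow> (\<integral>x. g x \<bullet> grad \<eta> x \<partial>lebesgue_on \<Omega>)"
    and lap: "(\<lambda>k. \<integral>x. \<psi> k x \<bullet> laplacian \<eta> x \<partial>lebesgue_on \<Omega>)
      \<longlonglongrightarrow> (\<integral>x. u x \<bullet> laplacian \<eta> x \<partial>lebesgue_on \<Omega>)"
    by (auto intro!: L2_on_inner_tendsto intro: lim L2 simp del: inner_real_def)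
  have "(\<integral>x. grad (\<psi> k) x \<bullet> grad \<eta> x \<partial>lebesgue_on \<Omega>)
      = - (\<integral>x. \<psi> k x \<bullet> laplacian \<eta> x \<partial>lebesgue_on \<Omega>)" for k
    using test_function_integral_by_parts[OF assms(1,2) \<psi> \<eta>] by simp
  with grad have "(\<lambda>k. - (\<integral>x. \<psi> k x \<bullet> laplacian \<eta> x \<partial>lebesgue_on \<Omega>))
      \<longlonglongrightarrow> (\<integral>x. g x \<bullet> grad \<eta> x \<partial>lebesgue_on \<Omega>)" by simp
  from LIMSEQ_unique[OF this tendsto_minus[OF lap]] show ?thesis by simp
qed

section \<open>Positive weak solutions\<close>

definition flat' :: "real \<Rightarrow> real" where
  "flat' = flat_poly [:0, 0, 1:]"

text \<open>With s = 1/t, \<open>flat'\<close> is s^2 e^(-s), and \<open>flat_step\<close> sends s^2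
  to s^2 (s^2 - 2 s) = s^4 - 2 s^3.\<close>

definition flat'' :: "real \<Rightarrow> real" where
  "flat'' = flat_poly [:0, 0, 0, -2, 1:]"

lemma flat_has_derivative: "(flat has_real_derivative flat' t) (at t)"
  using flat_poly_has_derivative[of 1 t] by (simp add: flat_def flat'_def flat_step_def)

lemma flat'_has_derivative: "(flat' has_real_derivative flat'' t) (at t)"
  using flat_poly_has_derivative[of "[:0, 0, 1:]" t]
  by (simp add: flat'_def flat''_def flat_step_def pderiv_pCons)

lemma flat_nonneg: "0 \<le> flat t"
  by (simp add: flat_def flat_poly_def)

lemma flat_le_1: "flat t \<le> 1"
  by (simp add: flat_def flat_poly_def)

lemma flat_0: "flat 0 = 0"
  by (simp add: flat_def flat_poly_def)

lemma flat'_nonneg: "0 \<le> flat' t"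
  by (simp add: flat'_def flat_poly_def)

text \<open>With s = 1/t this is s^2 / 2 \<le> e^s, from the quadratic term of the exponential
  series. It makes 2 a Lipschitz constant of \<open>flat\<close>.\<close>

lemma flat'_le_2: "flat' t \<le> 2"
proof (cases "t > 0")
  case True
  have "(1 / t)\<^sup>2 / 2 \<le> exp (1 / t)"
    using exp_lower_Taylor_quadratic[of "1 / t"] True by (smt (verit) divide_pos_pos zero_less_one)
  then have "(1 / t)\<^sup>2 * exp (- (1 / t)) \<le> (2 * exp (1 / t)) * exp (- (1 / t))"
    by (intro mult_right_mono) auto
  also have "\<dots> = 2"
    by (simp add: exp_minus)
  finally have "(1 / t)\<^sup>2 * exp (- (1 / t)) \<le> 2" .
  with True show ?thesis
    by (simp add: flat'_def flat_poly_def power2_eq_square)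
qed (simp add: flat'_def flat_poly_def)

lemma flat_lipschitz: "\<bar>flat s - flat t\<bar> \<le> 2 * \<bar>s - t\<bar>"
proof -
  have *: "\<bar>flat s - flat t\<bar> \<le> 2 * \<bar>s - t\<bar>" if less: "s < t" for s t
  proof -
    obtain z where "flat t - flat s = (t - s) * flat' z"
      using MVT2[OF less, of flat flat'] flat_has_derivative by blast
    then have "\<bar>flat s - flat t\<bar> = \<bar>s - t\<bar> * flat' z"
      using flat'_nonneg[of z] by (metis abs_minus_commute abs_mult abs_of_nonneg)
    then show ?thesis
      using mult_left_mono[OF flat'_le_2, of "\<bar>s - t\<bar>" z] by simp
  qed
  show ?thesis
    using *[of s t] *[of t s] by (cases s t rule: linorder_cases) (auto simp: abs_minus_commute)
qed

lemma continuous_flat: "continuous_on S flat"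
  by (meson DERIV_isCont continuous_at_imp_continuous_on flat_has_derivative)

lemma flat_measurable [measurable]: "flat \<in> borel_measurable borel"
  by (intro borel_measurable_continuous_onI continuous_flat)

text \<open>As \<open>m\<close> grows, \<open>flat (m * u x)\<close> becomes the indicator of the
  set where \<open>u\<close> is positive; this lets the cutoff disappear in the limit.\<close>

lemma flat_mult_tendsto_1:
  assumes "t > 0"
  shows "(\<lambda>m. flat (real m * t)) \<longlonglongrightarrow> 1"
proof -
  have "((\<lambda>s. exp (- (1 / s))) \<longlongrightarrow> exp (- 0)) (at_top :: real filter)"
    by (intro tendsto_intros tendsto_divide_0[OF tendsto_const] filterlim_at_top_imp_at_infinity
        filterlim_ident)
  moreover have "filterlim (\<lambda>m. real m * t) at_top sequentially"
    using assms by (intro filterlim_at_top_mult_tendsto_pos[OF tendsto_const _ filterlim_real_sequentially]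
        ) simp
  ultimately have "(\<lambda>m. exp (- (1 / (real m * t)))) \<longlonglongrightarrow> exp (- 0)"
    by (rule filterlim_compose)
  moreover have "\<forall>\<^sub>F m in sequentially. exp (- (1 / (real m * t))) = flat (real m * t)"
    using eventually_gt_at_top[of 0]
    by eventually_elim (use assms in \<open>simp add: flat_def flat_poly_def\<close>)
  ultimately show ?thesis
    using Lim_transform_eventually by fastforce
qed

lemma smooth_diff_square: "smooth (\<lambda>x. (x - z) \<bullet> (x - z))"
proof -
  have "smooth (\<lambda>x. \<Sum>i\<in>UNIV. (x $ i + (- z $ i)) * (x $ i + (- z $ i)))"
    by (intro smooth_sum smooth_mult smooth_add smooth_nth smooth_const)
  then show ?thesis by (simp add: inner_vec_def)
qed

lemma laplacian_compose:
  assumes f: "smooth f" and h': "\<And>t. (h has_real_derivative h' t) (at t)"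
    and h'': "\<And>t. (h' has_real_derivative h'' t) (at t)"
  shows "laplacian (\<lambda>x. h (f x)) x
    = h'' (f x) * (grad f x \<bullet> grad f x) + h' (f x) * laplacian f x"
proof -
  have "grad (\<lambda>y. grad (\<lambda>x. h (f x)) y $ i) x $ i
      = h' (f x) * grad (\<lambda>y. grad f y $ i) x $ i + grad f x $ i * (h'' (f x) * grad f x $ i)" for i
  proof -
    have "grad (\<lambda>x. h (f x)) y $ i = h' (f y) * grad f y $ i" for y
      by (subst grad_compose[OF smooth_differentiable[OF f] h']) simp
    moreover have "(\<lambda>y. h' (f y)) differentiable (at x)"
      using differentiable_chain_at[OF smooth_differentiable[OF f], of h' x] h''[of "f x"]
      by (auto simp: o_def real_differentiable_def)
    ultimately show ?thesis
      by (simp add: grad_mult[OF _ smooth_differentiable[OF smooth_partial[OF f]]]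
          grad_compose[OF smooth_differentiable[OF f] h''])
  qed
  then show ?thesis
    by (simp add: laplacian_def inner_vec_def sum.distrib sum_distrib_left mult_ac)
qed

text \<open>The squared distance \<open>f\<close> satisfies |grad f|^2 = 4 f and has Laplacian 2n.
  Taking the squared distance as the variable keeps radial functions smooth at their centre.\<close>

lemma laplacian_radial:
  fixes z :: "real ^ 'n"
  assumes h': "\<And>t. (h has_real_derivative h' t) (at t)"
    and h'': "\<And>t. (h' has_real_derivative h'' t) (at t)"
  defines "f \<equiv> \<lambda>x. (x - z) \<bullet> (x - z)"
  shows "laplacian (\<lambda>x. h (f x)) x = 4 * f x * h'' (f x) + 2 * real CARD('n) * h' (f x)"
proof -
  have "(f has_derivative (\<lambda>v. 2 * ((y - z) \<bullet> v))) (at y)" for y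
    unfolding f_def by (auto intro!: derivative_eq_intros simp: inner_commute)
  from grad_nth[OF this] have grad: "grad f y $ i = 2 * (y $ i - z $ i)" for y i
    by (simp add: inner_axis)
  have "((\<lambda>y :: real ^ 'n. 2 * (y $ i - z $ i)) has_derivative (\<lambda>v. 2 * (v $ i - 0))) (at y)" for i y
    by (intro has_derivative_mult_right has_derivative_diff has_derivative_const
        bounded_linear_imp_has_derivative bounded_linear_vec_nth)
  from grad_nth[OF this] have "grad (\<lambda>y. grad f y $ i) y $ i = 2" for i y
    by (simp add: grad)
  then have "laplacian f x = 2 * real CARD('n)"
    by (simp add: laplacian_def)
  moreover have "grad f x \<bullet> grad f x = 4 * f x"
  proof -
    have "grad f x \<bullet> grad f x = (\<Sum>i\<in>UNIV. 2 * (x $ i - z $ i) * (2 * (x $ i - z $ i)))"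
      by (simp only: inner_vec_def grad inner_real_def)
    then show ?thesis
      by (simp add: f_def inner_vec_def sum_distrib_left algebra_simps)
  qed
  ultimately show ?thesis
    using laplacian_compose[OF smooth_diff_square[of z] h' h''] by (simp add: f_def)
qed

text \<open>The gradient \<open>g\<close> is an argument here, whereas
  \<open>dirichlet_eigenfunction\<close> hides it behind an existential quantifier; several
  estimates can then share the same \<open>g\<close>.\<close>

definition weak_solution where
  "weak_solution \<Omega> l u g \<longleftrightarrow> H10 \<Omega> u g \<and>
    (\<forall>\<psi>. test_function \<Omega> \<psi> \<longrightarrow>
      (\<integral>x. g x \<bullet> grad \<psi> x \<partial>lebesgue_on \<Omega>) = l * (\<integral>x. u x * \<psi> x \<partial>lebesgue_on \<Omega>))"

lemma weak_solution_H10: "weak_solution \<Omega> l u g \<Longrightarrow> H10 \<Omega> u g"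
  by (simp only: weak_solution_def)

lemma weak_solution_test:
  "weak_solution \<Omega> l u g \<Longrightarrow> test_function \<Omega> \<psi> \<Longrightarrow>
    (\<integral>x. g x \<bullet> grad \<psi> x \<partial>lebesgue_on \<Omega>) = l * (\<integral>x. u x * \<psi> x \<partial>lebesgue_on \<Omega>)"
  unfolding weak_solution_def by blast

section \<open>Nonlinear cutoffs and the subsolution inequality\<close>

lemma L2_on_dominated:
  fixes f :: "real ^ 'n \<Rightarrow> 'b::euclidean_space" and h :: "real ^ 'n \<Rightarrow> 'c::euclidean_space"
  assumes f: "L2_on \<Omega> f" and [measurable]: "h \<in> borel_measurable (lebesgue_on \<Omega>)"
    and le: "\<And>x. x \<in> \<Omega> \<Longrightarrow> norm (h x) \<le> B * norm (f x)"
  shows "L2_on \<Omega> h"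
proof -
  have int: "integrable (lebesgue_on \<Omega>) (\<lambda>x. B\<^sup>2 * (norm (f x))\<^sup>2)"
    using f by (simp add: L2_on_def)
  have AE: "AE x in lebesgue_on \<Omega>. norm ((norm (h x))\<^sup>2) \<le> norm (B\<^sup>2 * (norm (f x))\<^sup>2)"
  proof (rule AE_I2)
    fix x assume "x \<in> space (lebesgue_on \<Omega>)"
    then have "(norm (h x))\<^sup>2 \<le> (B * norm (f x))\<^sup>2"
      using le by (intro power_mono) (auto simp: space_restrict_space)
    then show "norm ((norm (h x))\<^sup>2) \<le> norm (B\<^sup>2 * (norm (f x))\<^sup>2)"
      by (simp add: power_mult_distrib)
  qed
  have "(\<lambda>x. (norm (h x))\<^sup>2) \<in> borel_measurable (lebesgue_on \<Omega>)" by measurable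
  from Bochner_Integration.integrable_bound[OF int this AE] assms(2) show ?thesis
    unfolding L2_on_def by (intro conjI)
qed

lemma L2_on_integrable_inner:
  fixes u v :: "real ^ 'n \<Rightarrow> 'b :: euclidean_space"
  shows "L2_on \<Omega> u \<Longrightarrow> L2_on \<Omega> v \<Longrightarrow> integrable (lebesgue_on \<Omega>) (\<lambda>x. u x \<bullet> v x)"
  unfolding L2_on_def by (elim conjE) (rule integrable_inner)

lemma L2_on_integrable_mult:
  fixes u v :: "real ^ 'n \<Rightarrow> real"
  shows "L2_on \<Omega> u \<Longrightarrow> L2_on \<Omega> v \<Longrightarrow> integrable (lebesgue_on \<Omega>) (\<lambda>x. u x * v x)"
  using L2_on_integrable_inner[of \<Omega> u v] by (simp only: inner_real_def)

text \<open>Since \<open>flat 0 = 0\<close>, the product inherits the compact support of \<psi>,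
  while \<eta> may be an arbitrary smooth function on the whole space.\<close>

lemma test_function_mult_flat:
  assumes \<psi>: "test_function \<Omega> \<psi>" and \<eta>: "smooth \<eta>"
  shows "test_function \<Omega> (\<lambda>x. \<eta> x * flat (m * \<psi> x))"
proof -
  have "smooth (\<lambda>x. \<eta> x * flat (m * \<psi> x))"
    by (intro smooth_mult \<eta> smooth_flat smooth_const test_function_smooth[OF \<psi>])
  moreover have sub: "closure {x. \<eta> x * flat (m * \<psi> x) \<noteq> 0} \<subseteq> closure {x. \<psi> x \<noteq> 0}"
    by (intro closure_mono) (auto simp: flat_0)
  moreover have "compact (closure {x. \<eta> x * flat (m * \<psi> x) \<noteq> 0})"
    using \<psi> bounded_subset[OF compact_imp_bounded sub]
    by (simp add: test_function_def bounded_subset[OF _ closure_subset])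
  moreover have "closure {x. \<eta> x * flat (m * \<psi> x) \<noteq> 0} \<subseteq> \<Omega>"
    using sub \<psi> unfolding test_function_def by (elim conjE) (rule subset_trans)
  ultimately show ?thesis
    unfolding test_function_def smooth_def by (intro conjI)
qed

text \<open>For fixed \<open>m\<close>, the map sending t to \<open>flat (m * t)\<close> is
  Lipschitz with constant \<open>2 * \<bar>m\<bar>\<close>, so it preserves convergence in
  L^2.\<close>

lemma L2_tendsto_flat:
  assumes "\<And>k. L2_on \<Omega> (\<psi> k)" "L2_on \<Omega> u" "L2_tendsto \<Omega> \<psi> u"
  shows "L2_tendsto \<Omega> (\<lambda>k x. flat (m * \<psi> k x)) (\<lambda>x. flat (m * u x))"
  unfolding L2_tendsto_def
proof (rule tendsto_sandwich[of "\<lambda>_. 0"])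
  have [measurable]: "\<psi> k \<in> borel_measurable (lebesgue_on \<Omega>)" "u \<in> borel_measurable (lebesgue_on \<Omega>)" for k
    using assms by (auto simp: L2_on_def)
  have int: "integrable (lebesgue_on \<Omega>) (\<lambda>x. (norm (\<psi> k x - u x))\<^sup>2)" for k
    using assms by (intro square_integrable_diff) (auto simp: L2_on_def)
  show "(\<lambda>k. (2 * m)\<^sup>2 * (\<integral>x. (norm (\<psi> k x - u x))\<^sup>2 \<partial>lebesgue_on \<Omega>)) \<longlonglongrightarrow> 0"
    using tendsto_mult_right_zero assms(3) unfolding L2_tendsto_def by blast
  show "\<forall>\<^sub>F k in sequentially. (\<integral>x. (norm (flat (m * \<psi> k x) - flat (m * u x)))\<^sup>2 \<partial>lebesgue_on \<Omega>)
      \<le> (2 * m)\<^sup>2 * (\<integral>x. (norm (\<psi> k x - u x))\<^sup>2 \<partial>lebesgue_on \<Omega>)"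
  proof (intro always_eventually allI)
    fix k
    have le: "(norm (flat (m * \<psi> k x) - flat (m * u x)))\<^sup>2 \<le> (2 * m)\<^sup>2 * (norm (\<psi> k x - u x))\<^sup>2" for x
    proof -
      have "\<bar>flat (m * \<psi> k x) - flat (m * u x)\<bar> \<le> 2 * \<bar>m * \<psi> k x - m * u x\<bar>"
        by (rule flat_lipschitz)
      also have "\<dots> = 2 * \<bar>m\<bar> * \<bar>\<psi> k x - u x\<bar>"
        by (simp add: abs_mult right_diff_distrib[symmetric])
      finally have "\<bar>flat (m * \<psi> k x) - flat (m * u x)\<bar>\<^sup>2 \<le> (2 * \<bar>m\<bar> * \<bar>\<psi> k x - u x\<bar>)\<^sup>2"
        by (rule power_mono) simp
      then show ?thesis by (simp add: power_mult_distrib)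
    qed
    have "integrable (lebesgue_on \<Omega>) (\<lambda>x. (norm (flat (m * \<psi> k x) - flat (m * u x)))\<^sup>2)"
      by (rule Bochner_Integration.integrable_bound[OF integrable_mult_right[OF int, of "(2 * m)\<^sup>2" k]])
        (use le in \<open>auto intro!: AE_I2\<close>)
    then have "(\<integral>x. (norm (flat (m * \<psi> k x) - flat (m * u x)))\<^sup>2 \<partial>lebesgue_on \<Omega>)
      \<le> (\<integral>x. (2 * m)\<^sup>2 * (norm (\<psi> k x - u x))\<^sup>2 \<partial>lebesgue_on \<Omega>)"
      by (rule integral_mono) (use le int in auto)
    then show "(\<integral>x. (norm (flat (m * \<psi> k x) - flat (m * u x)))\<^sup>2 \<partial>lebesgue_on \<Omega>)
      \<le> (2 * m)\<^sup>2 * (\<integral>x. (norm (\<psi> k x - u x))\<^sup>2 \<partial>lebesgue_on \<Omega>)" by simp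
  qed
qed auto

text \<open>Test with \<open>\<eta> * flat (m * \<psi> k)\<close>, where the test functions \<open>\<psi> k\<close> approximate \<open>u\<close>: it is supported in
  \<open>\<Omega>\<close> although \<open>\<eta>\<close> need not be, and \<open>flat' \<ge> 0\<close> gives the term with \<open>norm (g x)\<close> squared a favourable
  sign.\<close>

lemma weak_solution_flat_cutoff:
  fixes \<Omega> :: "(real ^ 'n) set"
  assumes \<Omega>: "open \<Omega>" "bounded \<Omega>" and u: "weak_solution \<Omega> l u g"
    and \<eta>: "smooth \<eta>" "\<And>x. 0 \<le> \<eta> x" and "m \<ge> 0"
  shows "(\<integral>x. flat (m * u x) * (g x \<bullet> grad \<eta> x) \<partial>lebesgue_on \<Omega>)
    \<le> l * (\<integral>x. flat (m * u x) * (u x * \<eta> x) \<partial>lebesgue_on \<Omega>)"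
proof -
  let ?M = "lebesgue_on \<Omega>"
  from u obtain \<psi> where \<psi>: "\<And>k::nat. test_function \<Omega> (\<psi> k)"
    and lim: "L2_tendsto \<Omega> \<psi> u" "L2_tendsto \<Omega> (\<lambda>k. grad (\<psi> k)) g" and L2: "L2_on \<Omega> u" "L2_on \<Omega> g"
    unfolding weak_solution_def H10_def by blast
  note [measurable] = L2[unfolded L2_on_def, THEN conjunct1]
  have [measurable]: "\<eta> \<in> borel_measurable ?M" "grad \<eta> \<in> borel_measurable ?M"
    by (intro continuous_measurable_lebesgue_on \<Omega> smooth_continuous smooth_continuous_grad \<eta>)+
  note s\<psi> = test_function_smooth[OF \<psi>]
  have L2\<psi>: "L2_on \<Omega> (\<psi> k)" for k
    by (intro L2_on_continuous \<Omega> smooth_continuous s\<psi>)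
  have L2grad: "L2_on \<Omega> (grad (\<psi> k))" for k
    by (intro L2_on_continuous \<Omega> smooth_continuous_grad s\<psi>)
  have L2one: "L2_on \<Omega> (\<lambda>_. 1 :: real)"
    by (intro L2_on_continuous \<Omega>) simp
  obtain B where B: "B > 0" "\<And>x. x \<in> \<Omega> \<Longrightarrow> norm (\<eta> x) \<le> B"
    using continuous_bounded_on[OF \<Omega>(2) smooth_continuous[OF \<eta>(1)]] by metis
  obtain B' where B': "B' > 0" "\<And>x. x \<in> \<Omega> \<Longrightarrow> norm (grad \<eta> x) \<le> B'"
    using continuous_bounded_on[OF \<Omega>(2) smooth_continuous_grad[OF \<eta>(1)]] by metis
  have L2a: "L2_on \<Omega> (\<lambda>x. g x \<bullet> grad \<eta> x)"
  proof (rule L2_on_dominated[OF L2(2), of _ B'])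
    fix x assume "x \<in> \<Omega>"
    then show "norm (g x \<bullet> grad \<eta> x) \<le> B' * norm (g x)"
      using Cauchy_Schwarz_ineq2[of "g x" "grad \<eta> x"] mult_left_mono[OF B'(2), of x "norm (g x)"]
      by (simp add: mult.commute)
  qed measurable
  have L2b: "L2_on \<Omega> (\<lambda>x. u x * \<eta> x)"
  proof (rule L2_on_dominated[OF L2(1), of _ B])
    fix x assume "x \<in> \<Omega>"
    then show "norm (u x * \<eta> x) \<le> B * norm (u x)"
      using mult_left_mono[OF B(2), of x "\<bar>u x\<bar>"] by (simp add: abs_mult mult.commute)
  qed measurable
  have L2p: "L2_on \<Omega> (\<lambda>x. flat (m * v x))" if "L2_on \<Omega> v" for v
  proof (rule L2_on_dominated[OF L2one, of _ 1])
    show "norm (flat (m * v x)) \<le> 1 * norm (1 :: real)" for x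
      using flat_nonneg[of "m * v x"] flat_le_1[of "m * v x"] by simp
    have [measurable]: "v \<in> borel_measurable ?M" using that by (simp add: L2_on_def)
    show "(\<lambda>x. flat (m * v x)) \<in> borel_measurable ?M" by measurable
  qed
  note limp = L2_tendsto_flat[OF L2\<psi> L2(1) lim(1), of m]
  have lim_a: "(\<lambda>k. \<integral>x. flat (m * \<psi> k x) * (g x \<bullet> grad \<eta> x) \<partial>?M)
      \<longlonglongrightarrow> (\<integral>x. flat (m * u x) * (g x \<bullet> grad \<eta> x) \<partial>?M)"
    using L2_on_inner_tendsto[OF L2p[OF L2\<psi>] L2p[OF L2(1)] L2a limp] by simp
  have lim_b: "(\<lambda>k. \<integral>x. flat (m * \<psi> k x) * (u x * \<eta> x) \<partial>?M)
      \<longlonglongrightarrow> (\<integral>x. flat (m * u x) * (u x * \<eta> x) \<partial>?M)"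
    using L2_on_inner_tendsto[OF L2p[OF L2\<psi>] L2p[OF L2(1)] L2b limp] by simp
  have lim_c: "(\<lambda>k. \<integral>x. norm (grad (\<psi> k) x - g x) * norm (g x) \<partial>?M) \<longlonglongrightarrow> 0"
    using L2 L2grad lim(2) by (intro L2_norm_mult_tendsto_0) (auto simp: L2_on_def L2_tendsto_def)
  \<comment> \<open>The derivative of \<open>flat (m * \<psi> k x)\<close> contributes a nonnegative
    weight times the inner product of \<open>g x\<close> and \<open>grad (\<psi> k) x\<close>. With
    \<open>g x\<close> in place of \<open>grad (\<psi> k) x\<close> this would be nonnegative and
    could be dropped; the replacement costs at most the subtracted integral, and
    \<open>2 * m * B\<close> bounds the weight.\<close>
  have key: "(\<integral>x. flat (m * \<psi> k x) * (g x \<bullet> grad \<eta> x) \<partial>?M)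
      - 2 * m * B * (\<integral>x. norm (grad (\<psi> k) x - g x) * norm (g x) \<partial>?M)
      \<le> l * (\<integral>x. flat (m * \<psi> k x) * (u x * \<eta> x) \<partial>?M)" for k
  proof -
    let ?\<chi> = "\<lambda>x. \<eta> x * flat (m * \<psi> k x)"
    have test: "test_function \<Omega> ?\<chi>"
      by (rule test_function_mult_flat[OF \<psi> \<eta>(1)])
    have grad\<chi>: "grad ?\<chi> x = \<eta> x *\<^sub>R ((m * flat' (m * \<psi> k x)) *\<^sub>R grad (\<psi> k) x)
        + flat (m * \<psi> k x) *\<^sub>R grad \<eta> x" for x
    proof -
      have inner: "((\<lambda>t. m * t) has_real_derivative m) (at t)" for t
        by (rule DERIV_cmult_Id)
      have "((\<lambda>t. flat (m * t)) has_real_derivative m * flat' (m * t)) (at t)" for t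
        by (rule DERIV_cong[OF DERIV_chain2[OF flat_has_derivative inner]]) simp
      from grad_compose[OF smooth_differentiable[OF s\<psi>] this]
      show ?thesis
        by (subst grad_mult)
          (auto intro!: smooth_differentiable \<eta> smooth_flat smooth_mult smooth_const s\<psi>)
    qed
    have intc: "integrable ?M (\<lambda>x. norm (grad (\<psi> k) x - g x) * norm (g x))"
      using L2 L2grad[of k]
      by (intro Cauchy_Schwarz_integral square_integrable_diff) (auto simp: L2_on_def)
    have inta: "integrable ?M (\<lambda>x. flat (m * \<psi> k x) * (g x \<bullet> grad \<eta> x))"
      by (intro L2_on_integrable_mult L2p L2\<psi> L2a)
    have "(\<integral>x. flat (m * \<psi> k x) * (g x \<bullet> grad \<eta> x) \<partial>?M)
      - 2 * m * B * (\<integral>x. norm (grad (\<psi> k) x - g x) * norm (g x) \<partial>?M)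
      = (\<integral>x. flat (m * \<psi> k x) * (g x \<bullet> grad \<eta> x)
          - 2 * m * B * (norm (grad (\<psi> k) x - g x) * norm (g x)) \<partial>?M)"
      using inta intc by simp
    also have "\<dots> \<le> (\<integral>x. g x \<bullet> grad ?\<chi> x \<partial>?M)"
    proof (rule integral_mono)
      show "integrable ?M (\<lambda>x. flat (m * \<psi> k x) * (g x \<bullet> grad \<eta> x)
          - 2 * m * B * (norm (grad (\<psi> k) x - g x) * norm (g x)))"
        using inta intc by simp
      show "integrable ?M (\<lambda>x. g x \<bullet> grad ?\<chi> x)"
        by (intro L2_on_integrable_inner L2 L2_on_continuous \<Omega> smooth_continuous_grad
            test_function_smooth[OF test])
      fix x assume "x \<in> space ?M"
      then have x: "x \<in> \<Omega>" by (simp add: space_restrict_space)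
      define d where "d = \<eta> x * (m * flat' (m * \<psi> k x))"
      have "d \<le> B * (m * 2)"
        unfolding d_def using B(1) B(2)[OF x] \<eta>(2)[of x] \<open>m \<ge> 0\<close>
        by (intro mult_mono) (auto simp: flat'_le_2 flat'_nonneg)
      have "d \<ge> 0" unfolding d_def using \<eta>(2)[of x] \<open>m \<ge> 0\<close> flat'_nonneg by simp
      define a where "a = g x \<bullet> grad (\<psi> k) x"
      define r where "r = norm (grad (\<psi> k) x - g x) * norm (g x)"
      have "a = g x \<bullet> g x + (grad (\<psi> k) x - g x) \<bullet> g x"
        by (simp add: a_def inner_diff_left) (simp add: inner_commute)
      then have "- r \<le> a"
        using Cauchy_Schwarz_ineq2[of "grad (\<psi> k) x - g x" "g x"] inner_ge_zero[of "g x"]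
        unfolding r_def by linarith
      then have "d * (- r) \<le> d * a" using \<open>d \<ge> 0\<close> by (rule mult_left_mono)
      moreover have "d * r \<le> B * (m * 2) * r"
        using \<open>d \<le> _\<close> by (rule mult_right_mono) (simp add: r_def)
      ultimately have "- (2 * m * B * r) \<le> d * a" by (simp add: mult_ac)
      then show "flat (m * \<psi> k x) * (g x \<bullet> grad \<eta> x)
          - 2 * m * B * (norm (grad (\<psi> k) x - g x) * norm (g x)) \<le> g x \<bullet> grad ?\<chi> x"
        by (simp add: grad\<chi> inner_add_right a_def[symmetric] r_def[symmetric] d_def mult.assoc)
    qed
    also have "\<dots> = l * (\<integral>x. u x * ?\<chi> x \<partial>?M)"
      by (rule weak_solution_test[OF u test])
    finally show ?thesis by (simp add: mult_ac)
  qed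
  \<comment> \<open>Here \<open>m\<close> is fixed and only \<open>k\<close> tends to infinity, so
    the factor \<open>2 * m * B\<close> is harmless and the error vanishes.\<close>
  have "(\<lambda>k. (\<integral>x. flat (m * \<psi> k x) * (g x \<bullet> grad \<eta> x) \<partial>?M)
      - 2 * m * B * (\<integral>x. norm (grad (\<psi> k) x - g x) * norm (g x) \<partial>?M))
      \<longlonglongrightarrow> (\<integral>x. flat (m * u x) * (g x \<bullet> grad \<eta> x) \<partial>?M) - 2 * m * B * 0"
    by (intro tendsto_intros lim_a lim_c)
  then show ?thesis
    using LIMSEQ_le[OF _ tendsto_mult_left[OF lim_b, of l]] key by auto
qed

text \<open>Letting \<open>m\<close> tend to infinity in \<open>weak_solution_flat_cutoff\<close>
  replaces \<open>flat (m * u x)\<close> by 1, since \<open>u\<close> is positive in \<Omega>;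
  Green's identity then moves the derivatives onto \<eta>. As \<eta> may be positive on the
  boundary, this says that the zero extension of \<open>u\<close> is a subsolution on the whole
  space.\<close>

lemma weak_solution_zero_extension_subsolution:
  fixes \<Omega> :: "(real ^ 'n) set"
  assumes \<Omega>: "open \<Omega>" "bounded \<Omega>" and u: "weak_solution \<Omega> l u g"
    and pos: "\<And>x. x \<in> \<Omega> \<Longrightarrow> 0 < u x"
    and \<eta>: "smooth \<eta>" "\<And>x. 0 \<le> \<eta> x"
  shows "- (\<integral>x. u x * laplacian \<eta> x \<partial>lebesgue_on \<Omega>) \<le> l * (\<integral>x. u x * \<eta> x \<partial>lebesgue_on \<Omega>)"
proof -
  let ?M = "lebesgue_on \<Omega>"
  have L2: "L2_on \<Omega> u" "L2_on \<Omega> g"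
    using weak_solution_H10[OF u] by (auto simp: H10_def)
  note [measurable] = L2[unfolded L2_on_def, THEN conjunct1]
  have lim: "(\<lambda>m. \<integral>x. flat (real m * u x) * v x \<partial>?M) \<longlonglongrightarrow> (\<integral>x. v x \<partial>?M)"
    if "integrable ?M v" for v
  proof (rule integral_dominated_convergence)
    have [measurable]: "v \<in> borel_measurable ?M" using that by simp
    show "(\<lambda>x. flat (real m * u x) * v x) \<in> borel_measurable ?M" for m by measurable
    show "integrable ?M (\<lambda>x. \<bar>v x\<bar>)" using that by simp
    show "AE x in ?M. (\<lambda>m. flat (real m * u x) * v x) \<longlonglongrightarrow> v x"
    proof (rule AE_I2)
      fix x assume "x \<in> space ?M"
      then have "u x > 0" using pos by (simp add: space_restrict_space)
      from tendsto_mult_right[OF flat_mult_tendsto_1[OF this], of "v x"]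
      show "(\<lambda>m. flat (real m * u x) * v x) \<longlonglongrightarrow> v x" by simp
    qed
    show "AE x in ?M. norm (flat (real m * u x) * v x) \<le> \<bar>v x\<bar>" for m
      using flat_nonneg flat_le_1
      by (intro AE_I2) (auto simp: abs_mult intro!: mult_left_le_one_le)
  qed (use that in simp)
  have "integrable ?M (\<lambda>x. g x \<bullet> grad \<eta> x)"
    by (intro L2_on_integrable_inner L2 L2_on_continuous \<Omega> smooth_continuous_grad \<eta>)
  moreover have "integrable ?M (\<lambda>x. u x * \<eta> x)"
    by (intro L2_on_integrable_mult L2 L2_on_continuous \<Omega> smooth_continuous \<eta>)
  ultimately have "(\<integral>x. g x \<bullet> grad \<eta> x \<partial>?M) \<le> l * (\<integral>x. u x * \<eta> x \<partial>?M)"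
    using LIMSEQ_le[OF lim tendsto_mult_left[OF lim, of _ l]]
      weak_solution_flat_cutoff[OF \<Omega> u \<eta>] of_nat_0_le_iff by blast
  moreover have "(\<integral>x. g x \<bullet> grad \<eta> x \<partial>?M) = - (\<integral>x. u x * laplacian \<eta> x \<partial>?M)"
    by (rule H10_integral_by_parts[OF \<Omega> weak_solution_H10[OF u] \<eta>(1)])
  ultimately show ?thesis by simp
qed

section \<open>Upper bound for the eigenvalue from an inscribed ball\<close>

lemma integral_pos_of_pos_on_ball:
  fixes f :: "real ^ 'n \<Rightarrow> real"
  assumes f: "integrable (lebesgue_on \<Omega>) f" "\<And>x. x \<in> \<Omega> \<Longrightarrow> 0 \<le> f x" and "open \<Omega>"
    and ball: "r > 0" "ball z r \<subseteq> \<Omega>" "\<And>x. x \<in> ball z r \<Longrightarrow> 0 < f x"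
  shows "0 < (\<integral>x. f x \<partial>lebesgue_on \<Omega>)"
proof -
  have nn: "AE x in lebesgue_on \<Omega>. 0 \<le> f x"
    using f(2) by (intro AE_I2) (simp add: space_restrict_space)
  have "(\<integral>x. f x \<partial>lebesgue_on \<Omega>) \<noteq> 0"
  proof
    assume "(\<integral>x. f x \<partial>lebesgue_on \<Omega>) = 0"
    then have "AE x in lebesgue_on \<Omega>. f x = 0"
      using integral_nonneg_eq_0_iff_AE[OF f(1) nn] by simp
    then have "AE x in lebesgue. x \<in> \<Omega> \<longrightarrow> f x = 0"
      using \<open>open \<Omega>\<close> by (subst (asm) AE_restrict_space_iff) auto
    then have "AE x in lebesgue. x \<notin> ball z r"
      by eventually_elim (use ball in force)
    then have "negligible (ball z r)"
      by (simp add: negligible_iff_null_sets AE_iff_null_sets)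
    then show False
      using open_not_negligible[of "ball z r"] ball(1) by simp
  qed
  moreover have "0 \<le> (\<integral>x. f x \<partial>lebesgue_on \<Omega>)"
    using nn by (rule integral_nonneg_AE)
  ultimately show ?thesis by simp
qed

text \<open>The bump is an explicit substitute for the first eigenfunction of the ball. In terms of
  s = 1/q its negative Laplacian is the bump times a polynomial in s with leading term -4 s^4 /
  \<rho>^2; such a polynomial is bounded above, even as s tends to infinity at the edge of the
  ball.\<close>

lemma minus_laplacian_bump_le:
  fixes z :: "real ^ 'n"
  assumes "\<rho> > 0"
  shows "- laplacian (\<lambda>x. flat (1 - ((x - z) \<bullet> (x - z)) / \<rho>\<^sup>2)) x
    \<le> (real CARD('n) + 5)\<^sup>2 / (2 * \<rho>\<^sup>2) * flat (1 - ((x - z) \<bullet> (x - z)) / \<rho>\<^sup>2)"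
proof -
  define n where "n = real CARD('n)"
  define q where "q = 1 - ((x - z) \<bullet> (x - z)) / \<rho>\<^sup>2"
  have r4: "\<rho> ^ 4 = \<rho>\<^sup>2 * \<rho>\<^sup>2" by (simp add: power2_eq_square power4_eq_xxxx)
  have inner: "((\<lambda>t. 1 - t / \<rho>\<^sup>2) has_real_derivative - 1 / \<rho>\<^sup>2) (at t)" for t
    by (rule DERIV_cong[OF DERIV_diff[OF DERIV_const DERIV_cdivide[OF DERIV_ident]]]) simp
  have "((\<lambda>t. flat (1 - t / \<rho>\<^sup>2)) has_real_derivative - flat' (1 - t / \<rho>\<^sup>2) / \<rho>\<^sup>2) (at t)" for t
    by (rule DERIV_cong[OF DERIV_chain2[OF flat_has_derivative inner]]) simp
  moreover have "((\<lambda>t. - flat' (1 - t / \<rho>\<^sup>2) / \<rho>\<^sup>2) has_real_derivative flat'' (1 - t / \<rho>\<^sup>2) / \<rho> ^ 4) (at t)" for t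
    by (rule DERIV_cong[OF DERIV_cdivide[OF DERIV_minus[OF DERIV_chain2[OF flat'_has_derivative inner]]]])
      (use assms in \<open>simp add: field_simps power2_eq_square power4_eq_xxxx\<close>)
  ultimately have lap0: "laplacian (\<lambda>x. flat (1 - ((x - z) \<bullet> (x - z)) / \<rho>\<^sup>2)) x
    = 4 * ((x - z) \<bullet> (x - z)) * (flat'' q / \<rho> ^ 4) + 2 * n * (- flat' q / \<rho>\<^sup>2)"
    unfolding q_def n_def by (rule laplacian_radial)
  have dist: "(x - z) \<bullet> (x - z) = \<rho>\<^sup>2 * (1 - q)"
    using assms by (simp add: q_def)
  have lap: "- laplacian (\<lambda>x. flat (1 - ((x - z) \<bullet> (x - z)) / \<rho>\<^sup>2)) x
    = (2 * n * flat' q - 4 * (1 - q) * flat'' q) / \<rho>\<^sup>2"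
  proof -
    have "- (4 * (r * (1 - q)) * (a / (r * r)) + 2 * n * (- b / r)) = (2 * n * b - 4 * (1 - q) * a) / r"
      if "r > 0" for r a b :: real
      using that by (simp add: field_simps)
    from this[of "\<rho>\<^sup>2"] show ?thesis
      using assms unfolding lap0 r4 dist by (metis zero_less_power)
  qed
  have "2 * n * flat' q - 4 * (1 - q) * flat'' q \<le> (n + 5)\<^sup>2 / 2 * flat q"
  proof (cases "q > 0")
    case True
    define s where "s = 1 / q"
    have s: "s > 0" "q = 1 / s" using True by (auto simp: s_def)
    have f: "flat' q = s\<^sup>2 * flat q" "flat'' q = (s ^ 4 - 2 * s ^ 3) * flat q"
      using True s by (simp_all add: flat_def flat'_def flat''_def flat_poly_def power2_eq_square
          power4_eq_xxxx power3_eq_cube algebra_simps)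
    have "2 * n * flat' q - 4 * (1 - q) * flat'' q
        = (2 * n * s\<^sup>2 - 4 * (1 - q) * (s ^ 4 - 2 * s ^ 3)) * flat q"
      unfolding f by (simp add: algebra_simps)
    also have "\<dots> \<le> (n + 5)\<^sup>2 / 2 * flat q"
    proof (rule mult_right_mono[OF _ flat_nonneg])
      have "q * s ^ 4 = s ^ 3" "q * s ^ 3 = s ^ 2"
        using s by (simp_all add: power2_eq_square power4_eq_xxxx power3_eq_cube)
      then have "2 * n * s\<^sup>2 - 4 * (1 - q) * (s ^ 4 - 2 * s ^ 3)
        = (2 * n - 8) * s\<^sup>2 - 4 * s ^ 4 + 12 * s ^ 3"
        by (simp add: algebra_simps)
      \<comment> \<open>Two completed squares: the first absorbs the cubic term, the second the
        remaining quadratic one, and the constant left over is the bound.\<close>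
      also have "\<dots> = (n + 5)\<^sup>2 / 2 - (2 * (s * (s - 3))\<^sup>2 + 2 * (s\<^sup>2 - (n + 5) / 2)\<^sup>2)"
        by (simp add: power2_eq_square power4_eq_xxxx power3_eq_cube field_simps)
      also have "\<dots> \<le> (n + 5)\<^sup>2 / 2" by simp
      finally show "2 * n * s\<^sup>2 - 4 * (1 - q) * (s ^ 4 - 2 * s ^ 3) \<le> (n + 5)\<^sup>2 / 2" .
    qed
    finally show ?thesis .
  qed (simp add: flat_def flat'_def flat''_def flat_poly_def)
  then have "(2 * n * flat' q - 4 * (1 - q) * flat'' q) / \<rho>\<^sup>2 \<le> ((n + 5)\<^sup>2 / 2 * flat q) / \<rho>\<^sup>2"
    by (rule divide_right_mono) simp
  then show ?thesis
    unfolding lap by (simp add: n_def[symmetric] q_def[symmetric])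
qed

text \<open>Since the closed ball lies in \<Omega>, the bump is a test function. Moving both
  derivatives onto it and inserting the bound on its negative Laplacian compares \<open>l\<close>
  with \<open>c\<close> after division by the positive integral of \<open>u x * \<psi> x\<close>;
  positivity of \<open>u\<close> does the work that a variational characterisation of
  \<open>l\<close> would do.\<close>

lemma positive_weak_solution_eigenvalue_le:
  fixes \<Omega> :: "(real ^ 'n) set"
  assumes \<Omega>: "open \<Omega>" "bounded \<Omega>" and u: "weak_solution \<Omega> l u g"
    and pos: "\<And>x. x \<in> \<Omega> \<Longrightarrow> 0 < u x"
    and "\<rho> > 0" and ball: "cball z \<rho> \<subseteq> \<Omega>"
  shows "l \<le> (real CARD('n) + 5)\<^sup>2 / (2 * \<rho>\<^sup>2)"
proof -
  let ?M = "lebesgue_on \<Omega>"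
  define c where "c = (real CARD('n) + 5)\<^sup>2 / (2 * \<rho>\<^sup>2)"
  define \<psi> where "\<psi> = (\<lambda>x. flat (1 - ((x - z) \<bullet> (x - z)) / \<rho>\<^sup>2))"
  have "smooth (\<lambda>x. flat (1 + (- 1 / \<rho>\<^sup>2) * ((x - z) \<bullet> (x - z))))"
    by (intro smooth_flat smooth_add smooth_const smooth_mult smooth_diff_square)
  then have s\<psi>: "smooth \<psi>" by (simp add: \<psi>_def)
  have \<psi>_pos: "0 < \<psi> x \<longleftrightarrow> x \<in> ball z \<rho>" for x
  proof -
    have "0 < \<psi> x \<longleftrightarrow> (norm (x - z))\<^sup>2 < \<rho>\<^sup>2"
      using \<open>\<rho> > 0\<close> by (simp add: \<psi>_def flat_pos_iff power2_norm_eq_inner)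
    also have "\<dots> \<longleftrightarrow> norm (x - z) < \<rho>"
      using power_mono_iff[of \<rho> "norm (x - z)" 2] \<open>\<rho> > 0\<close> by (simp add: not_le[symmetric])
    finally show ?thesis by (simp add: dist_norm norm_minus_commute)
  qed
  have \<psi>_nonneg: "0 \<le> \<psi> x" for x by (simp add: \<psi>_def flat_nonneg)
  have "\<psi> x \<noteq> 0 \<longleftrightarrow> x \<in> ball z \<rho>" for x
    using \<psi>_pos[of x] \<psi>_nonneg[of x] by linarith
  then have "{x. \<psi> x \<noteq> 0} = ball z \<rho>" by blast
  then have test: "test_function \<Omega> \<psi>"
    using s\<psi> ball \<open>\<rho> > 0\<close> unfolding test_function_def smooth_def by simp
  have L2: "L2_on \<Omega> u"
    using weak_solution_H10[OF u] by (auto simp: H10_def)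
  have int1: "integrable ?M (\<lambda>x. u x * \<psi> x)"
    by (intro L2_on_integrable_mult L2 L2_on_continuous \<Omega> smooth_continuous s\<psi>)
  have int2: "integrable ?M (\<lambda>x. u x * laplacian \<psi> x)"
    by (intro L2_on_integrable_mult L2 L2_on_continuous \<Omega> smooth_continuous smooth_laplacian s\<psi>)
  have pos_int: "0 < (\<integral>x. u x * \<psi> x \<partial>?M)"
  proof (rule integral_pos_of_pos_on_ball[OF int1 _ \<Omega>(1) \<open>\<rho> > 0\<close>])
    show "ball z \<rho> \<subseteq> \<Omega>" using ball ball_subset_cball by blast
    then show "0 < u x * \<psi> x" if "x \<in> ball z \<rho>" for x
      using that pos \<psi>_pos by (intro mult_pos_pos) auto
    show "0 \<le> u x * \<psi> x" if "x \<in> \<Omega>" for x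
      using pos[OF that] \<psi>_nonneg by simp
  qed
  have "l * (\<integral>x. u x * \<psi> x \<partial>?M) = (\<integral>x. g x \<bullet> grad \<psi> x \<partial>?M)"
    by (rule weak_solution_test[OF u test, symmetric])
  also have "\<dots> = - (\<integral>x. u x * laplacian \<psi> x \<partial>?M)"
    by (rule H10_integral_by_parts[OF \<Omega> weak_solution_H10[OF u] s\<psi>])
  also have "\<dots> = (\<integral>x. u x * (- laplacian \<psi> x) \<partial>?M)" by simp
  also have "\<dots> \<le> (\<integral>x. c * (u x * \<psi> x) \<partial>?M)"
  proof (rule integral_mono)
    show "integrable ?M (\<lambda>x. u x * (- laplacian \<psi> x))" using int2 by simp
    show "integrable ?M (\<lambda>x. c * (u x * \<psi> x))" using int1 by simp
    fix x assume "x \<in> space ?M"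
    then have "u x * (- laplacian \<psi> x) \<le> u x * (c * \<psi> x)"
      using minus_laplacian_bump_le[OF \<open>\<rho> > 0\<close>, of z x] pos[of x]
      by (intro mult_left_mono) (auto simp: space_restrict_space \<psi>_def c_def)
    then show "u x * (- laplacian \<psi> x) \<le> c * (u x * \<psi> x)" by (simp add: mult_ac)
  qed
  also have "\<dots> = c * (\<integral>x. u x * \<psi> x \<partial>?M)" by simp
  finally have "l * (\<integral>x. u x * \<psi> x \<partial>?M) \<le> c * (\<integral>x. u x * \<psi> x \<partial>?M)" .
  with pos_int have "l \<le> c" by simp
  then show ?thesis by (simp only: c_def)
qed

section \<open>Gaussian averages of the ground state\<close>

lemma lborel_integral_affine:
  fixes f :: "'a::euclidean_space \<Rightarrow> real"
  assumes c: "c \<noteq> 0" and [measurable]: "f \<in> borel_measurable borel"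
  shows "(\<integral>x. f x \<partial>lborel) = \<bar>c\<bar> ^ DIM('a) * (\<integral>x. f (t + c *\<^sub>R x) \<partial>lborel)"
  by (subst lborel_affine[OF c, of t]) (simp add: integral_density integral_distr)

lemma integrable_lborel_affine:
  fixes f :: "'a::euclidean_space \<Rightarrow> real"
  assumes c: "c \<noteq> 0" and [measurable]: "f \<in> borel_measurable borel"
    and "integrable lborel (\<lambda>x. f (t + c *\<^sub>R x))"
  shows "integrable lborel f"
  by (subst lborel_affine[OF c, of t])
    (use assms in \<open>simp add: integrable_density integrable_distr_eq\<close>)

text \<open>Up to normalisation, the heat kernel at time 1/4.\<close>

definition gaussian :: "'a::euclidean_space \<Rightarrow> real" where
  "gaussian x = exp (- (x \<bullet> x))"

lemma gaussian_measurable [measurable]: "gaussian \<in> borel_measurable borel"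
  unfolding gaussian_def[abs_def] by measurable

lemma gaussian_pos: "0 < gaussian x"
  by (simp add: gaussian_def)

text \<open>The Gaussian is a product of functions of single coordinates, so its integral is a power
  of the one-dimensional Gaussian integral, which is finite.\<close>

lemma integrable_gaussian: "integrable lborel (gaussian :: 'a::euclidean_space \<Rightarrow> real)"
proof (rule integrableI_nonneg)
  have fin: "(\<integral>\<^sup>+t. ennreal (exp (- t\<^sup>2)) \<partial>lborel) < \<infinity>"
  proof -
    have "integrable lborel (\<lambda>t :: real. exp (- t\<^sup>2))"
      using has_bochner_integral_even_function[OF gaussian_moment_0] by (auto simp: has_bochner_integral_iff)
    then show ?thesis by (simp add: integrable_iff_bounded)
  qed
  have "gaussian x = (\<Prod>b\<in>Basis. exp (- (x \<bullet> b)\<^sup>2))" for x :: 'a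
    by (simp add: gaussian_def exp_sum[symmetric] sum_negf euclidean_inner[of x x] power2_eq_square)
  then have "(\<integral>\<^sup>+(x :: 'a). ennreal (gaussian x) \<partial>lborel)
      = (\<integral>\<^sup>+(x :: 'a). (\<Prod>b\<in>Basis. ennreal (exp (- (x \<bullet> b)\<^sup>2))) \<partial>lborel)"
    by (simp add: prod_ennreal)
  also have "\<dots> = (\<Prod>b\<in>(Basis :: 'a set). \<integral>\<^sup>+t. ennreal (exp (- t\<^sup>2)) \<partial>lborel)"
    by (rule nn_integral_lborel_prod[where f="\<lambda>_ t. ennreal (exp (- t\<^sup>2))"]) auto
  also have "\<dots> < \<infinity>"
    using fin by (simp add: power_less_top_ennreal)
  finally show "(\<integral>\<^sup>+(x :: 'a). ennreal (gaussian x) \<partial>lborel) < \<infinity>" .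
qed (auto simp: gaussian_pos less_imp_le)

text \<open>The normalising constant, classically \<pi>^(n/2), is carried as a symbol. The argument
  only transports the type, and with it the dimension.\<close>

definition gaussian_mass :: "'a::euclidean_space itself \<Rightarrow> real" where
  "gaussian_mass _ = (\<integral>x. gaussian (x :: 'a) \<partial>lborel)"

lemma gaussian_mass_nonneg: "0 \<le> gaussian_mass TYPE('a::euclidean_space)"
  unfolding gaussian_mass_def by (intro integral_nonneg_AE AE_I2) (simp add: gaussian_pos less_imp_le)

text \<open>By convexity the tangents at \<open>a\<close> and at \<open>b\<close> place the
  remainder between 0 and \<open>(b - a) * (exp b - exp a)\<close>, and \<open>exp\<close> has
  Lipschitz constant 1 on the nonpositive numbers.\<close>

lemma exp_first_order_remainder:
  fixes a b :: real
  assumes "a \<le> 0" "b \<le> 0"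
  shows "\<bar>exp b - exp a - (b - a) * exp a\<bar> \<le> (b - a)\<^sup>2"
proof -
  have tangent: "(y - x) * exp x \<le> exp y - exp x" for x y :: real
  proof -
    have "exp x * (1 + (y - x)) \<le> exp x * exp (y - x)"
      by (intro mult_left_mono exp_ge_add_one_self) simp
    then show ?thesis by (simp add: exp_diff algebra_simps)
  qed
  have lip: "\<bar>exp b - exp a\<bar> \<le> \<bar>b - a\<bar>"
  proof -
    have "y * exp x \<le> \<bar>y\<bar>" if "x \<le> 0" for x y :: real
    proof -
      have "y * exp x \<le> \<bar>y\<bar> * exp x" by (intro mult_right_mono) auto
      also have "\<dots> \<le> \<bar>y\<bar> * 1" using that by (intro mult_left_mono) auto
      finally show ?thesis by simp
    qed
    from this[OF \<open>a \<le> 0\<close>, of "a - b"] this[OF \<open>b \<le> 0\<close>, of "b - a"] show ?thesis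
      using tangent[where x=a and y=b] tangent[where x=b and y=a] by (simp add: algebra_simps)
  qed
  have "exp b - exp a - (b - a) * exp a \<le> (b - a) * (exp b - exp a)"
    using tangent[where x=b and y=a] by (simp add: algebra_simps)
  also have "\<dots> \<le> \<bar>b - a\<bar> * \<bar>exp b - exp a\<bar>" by (simp add: abs_mult[symmetric])
  also have "\<dots> \<le> \<bar>b - a\<bar> * \<bar>b - a\<bar>" by (intro mult_left_mono lip) simp
  finally show ?thesis
    using tangent[where x=a and y=b] by (simp add: power2_eq_square)
qed

text \<open>The bound \<open>F\<close> makes the first-order remainder of the exponential at most
  \<open>h^2 * F^2\<close> uniformly in \<open>x\<close>. Integrating it against \<open>u\<close>
  leaves an error of order \<open>h^2\<close>, so the difference quotient converges.\<close>

lemma laplace_transform_has_derivative: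
  fixes u f :: "'a \<Rightarrow> real"
  assumes u: "integrable M u" and [measurable]: "f \<in> borel_measurable M"
    and f: "\<And>x. x \<in> space M \<Longrightarrow> 0 \<le> f x" "\<And>x. x \<in> space M \<Longrightarrow> f x \<le> F" and "s > 0"
  shows "((\<lambda>s. \<integral>x. u x * exp (- s * f x) \<partial>M) has_real_derivative
      - (\<integral>x. u x * f x * exp (- s * f x) \<partial>M)) (at s)"
proof -
  have [measurable]: "u \<in> borel_measurable M" using u by simp
  have int: "integrable M (\<lambda>x. u x * exp (- t * f x))" if "t > 0" for t
    by (rule Bochner_Integration.integrable_bound[OF u])
      (use that f in \<open>auto intro!: AE_I2 mult_right_le_one_le simp: abs_mult\<close>)
  have int': "integrable M (\<lambda>x. u x * f x * exp (- s * f x))"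
  proof (rule Bochner_Integration.integrable_bound[OF integrable_mult_right[OF u, of F]])
    show "AE x in M. norm (u x * f x * exp (- s * f x)) \<le> norm (F * u x)"
    proof (rule AE_I2)
      fix x assume x: "x \<in> space M"
      then have "f x * exp (- s * f x) \<le> F * 1"
        using f[OF x] \<open>s > 0\<close> by (intro mult_mono) auto
      then have "\<bar>u x\<bar> * (f x * exp (- s * f x)) \<le> \<bar>u x\<bar> * (F * 1)"
        by (rule mult_left_mono) simp
      then show "norm (u x * f x * exp (- s * f x)) \<le> norm (F * u x)"
        using f[OF x] by (simp add: abs_mult mult_ac)
    qed
  qed measurable
  define V where "V t = (\<integral>x. u x * exp (- t * f x) \<partial>M)" for t
  define D where "D = - (\<integral>x. u x * f x * exp (- s * f x) \<partial>M)"
  define K where "K = F\<^sup>2 * (\<integral>x. \<bar>u x\<bar> \<partial>M)"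
  \<comment> \<open>The restriction on \<open>h\<close> keeps \<open>s + h\<close> positive, so both
    exponents are nonpositive, as \<open>exp_first_order_remainder\<close> requires.\<close>
  have bound: "\<bar>V (s + h) - V s - h * D\<bar> \<le> h\<^sup>2 * K" if "\<bar>h\<bar> < s" for h
  proof -
    have "s + h > 0" using that by linarith
    define R where "R x = exp (- (s + h) * f x) - exp (- s * f x) + h * f x * exp (- s * f x)" for x
    have "V (s + h) - V s - h * D = (\<integral>x. u x * exp (- (s + h) * f x) - u x * exp (- s * f x)
        + h * (u x * f x * exp (- s * f x)) \<partial>M)"
      unfolding V_def D_def using int[OF \<open>s + h > 0\<close>] int[OF \<open>s > 0\<close>] int' by simp
    also have "\<dots> = (\<integral>x. u x * R x \<partial>M)"
      by (intro Bochner_Integration.integral_cong) (auto simp: R_def algebra_simps)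
    also have "\<bar>\<dots>\<bar> \<le> (\<integral>x. h\<^sup>2 * F\<^sup>2 * \<bar>u x\<bar> \<partial>M)"
    proof (rule order_trans[OF integral_abs_bound integral_mono])
      have "integrable M (\<lambda>x. u x * exp (- (s + h) * f x) - u x * exp (- s * f x)
        + h * (u x * f x * exp (- s * f x)))"
        using int[OF \<open>s + h > 0\<close>] int[OF \<open>s > 0\<close>] int' by simp
      then have "integrable M (\<lambda>x. u x * R x)" by (simp add: R_def algebra_simps)
      then show "integrable M (\<lambda>x. \<bar>u x * R x\<bar>)" by (rule integrable_abs)
      show "integrable M (\<lambda>x. h\<^sup>2 * F\<^sup>2 * \<bar>u x\<bar>)" using u by simp
      fix x assume x: "x \<in> space M"
      have "\<bar>R x\<bar> \<le> (h * f x)\<^sup>2"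
      proof -
        have "- s * f x \<le> 0" "- (s + h) * f x \<le> 0"
          using f(1)[OF x] \<open>s > 0\<close> \<open>s + h > 0\<close> by (simp_all add: mult_nonneg_nonneg mult_nonpos_nonneg)
        from exp_first_order_remainder[OF this] show ?thesis
          by (simp add: R_def algebra_simps)
      qed
      also have "\<dots> \<le> h\<^sup>2 * F\<^sup>2"
        using f[OF x] by (simp add: power_mult_distrib mult_left_mono power_mono)
      finally have "\<bar>u x\<bar> * \<bar>R x\<bar> \<le> \<bar>u x\<bar> * (h\<^sup>2 * F\<^sup>2)" by (rule mult_left_mono) simp
      then show "\<bar>u x * R x\<bar> \<le> h\<^sup>2 * F\<^sup>2 * \<bar>u x\<bar>" by (simp add: abs_mult mult_ac)
    qed
    finally show ?thesis by (simp add: K_def mult_ac)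
  qed
  have "((\<lambda>h. (V (s + h) - V s) / h - D) \<longlongrightarrow> 0) (at 0)"
  proof (rule Lim_null_comparison)
    show "\<forall>\<^sub>F h in at 0. norm ((V (s + h) - V s) / h - D) \<le> \<bar>h\<bar> * K"
      unfolding eventually_at
    proof (intro exI[of _ s] conjI ballI impI \<open>s > 0\<close>)
      fix h :: real
      assume h: "h \<noteq> 0 \<and> dist h 0 < s"
      then have "(V (s + h) - V s) / h - D = (V (s + h) - V s - h * D) / h"
        by (simp add: field_simps)
      moreover have "\<bar>V (s + h) - V s - h * D\<bar> / \<bar>h\<bar> \<le> h\<^sup>2 * K / \<bar>h\<bar>"
        using bound[of h] h by (intro divide_right_mono) auto
      moreover have "h\<^sup>2 * K / \<bar>h\<bar> = \<bar>h\<bar> * K"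
        using h by (simp add: field_simps power2_eq_square flip: abs_mult)
      ultimately show "norm ((V (s + h) - V s) / h - D) \<le> \<bar>h\<bar> * K" by simp
    qed
    have "((\<lambda>h. \<bar>h\<bar> * K) \<longlongrightarrow> \<bar>0\<bar> * K) (at 0)" by (intro tendsto_intros)
    then show "((\<lambda>h. \<bar>h\<bar> * K) \<longlongrightarrow> 0) (at 0)" by simp
  qed
  then have "((\<lambda>h. (V (s + h) - V s) / h) \<longlongrightarrow> D) (at 0)" by (rule LIM_zero_cancel)
  then show ?thesis unfolding DERIV_def V_def D_def .
qed

text \<open>With \<open>s = 1/(4t)\<close>, the quantity \<open>W\<close> is up to a constant \<open>e\<^sup>l\<^sup>t\<close> times the heat evolution at time \<open>t\<close> of the
  zero extension of \<open>u\<close>, evaluated at \<open>z\<close>.\<close>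

lemma weak_solution_heat_monotone:
  fixes \<Omega> :: "(real ^ 'n) set" and z :: "real ^ 'n"
  assumes \<Omega>: "open \<Omega>" "bounded \<Omega>" and u: "weak_solution \<Omega> l u g"
    and pos: "\<And>x. x \<in> \<Omega> \<Longrightarrow> 0 < u x"
    and s: "0 < s" "s \<le> t"
  defines "W \<equiv> \<lambda>s. exp (l / (4 * s) + real CARD('n) / 2 * ln s)
      * (\<integral>x. u x * exp (- s * ((x - z) \<bullet> (x - z))) \<partial>lebesgue_on \<Omega>)"
  shows "W t \<le> W s"
proof (rule DERIV_nonpos_imp_nonincreasing[OF s(2)])
  fix r assume "s \<le> r" "r \<le> t"
  with s have r: "r > 0" by simp
  let ?M = "lebesgue_on \<Omega>"
  define n where "n = real CARD('n)"
  define f where "f x = (x - z) \<bullet> (x - z)" for x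
  define e where "e x = exp (- r * f x)" for x
  have sf: "smooth f" unfolding f_def[abs_def] by (rule smooth_diff_square)
  have se: "smooth e"
    unfolding e_def[abs_def] by (intro smooth_exp smooth_mult smooth_const sf)
  have L2u: "L2_on \<Omega> u"
    using weak_solution_H10[OF u] by (auto simp: H10_def)
  have L2c: "L2_on \<Omega> h" if "smooth h" for h :: "real ^ 'n \<Rightarrow> real"
    by (rule L2_on_continuous[OF \<Omega> smooth_continuous[OF that]])
  have int_e: "integrable ?M (\<lambda>x. u x * e x)"
    by (rule L2_on_integrable_mult[OF L2u L2c[OF se]])
  have int_fe: "integrable ?M (\<lambda>x. u x * (f x * e x))"
    by (rule L2_on_integrable_mult[OF L2u L2c[OF smooth_mult[OF sf se]]])
  have int_u: "integrable ?M u"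
    using L2_on_integrable_mult[OF L2u L2c[OF smooth_const[of 1]]] by simp
  define V where "V = (\<integral>x. u x * e x \<partial>?M)"
  define V1 where "V1 = (\<integral>x. u x * (f x * e x) \<partial>?M)"
  have lap: "laplacian e x = 4 * r\<^sup>2 * (f x * e x) - 2 * n * r * e x" for x
  proof -
    have inner: "((\<lambda>t. - r * t) has_real_derivative - r) (at t)" for t
      by (rule DERIV_cmult_Id)
    have h': "((\<lambda>t. exp (- r * t)) has_real_derivative - r * exp (- r * t)) (at t)" for t
      by (rule DERIV_cong[OF DERIV_chain2[OF DERIV_exp inner]]) simp
    have h'': "((\<lambda>t. - r * exp (- r * t)) has_real_derivative - r * (- r * exp (- r * t))) (at t)" for t
      by (rule DERIV_cmult[OF h'])
    from laplacian_radial[OF h' h'', of z x] show ?thesis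
      unfolding e_def[abs_def] f_def n_def by (simp add: power2_eq_square algebra_simps)
  qed
  \<comment> \<open>The Gaussian is positive on the boundary of \<Omega>, so it is no test function;
    the inequality for the zero extension is what applies to it.\<close>
  have "- (\<integral>x. u x * laplacian e x \<partial>?M) \<le> l * V"
    unfolding V_def
    by (rule weak_solution_zero_extension_subsolution[OF \<Omega> u pos se]) (simp_all add: e_def)
  also have "(\<integral>x. u x * laplacian e x \<partial>?M)
      = (\<integral>x. 4 * r\<^sup>2 * (u x * (f x * e x)) - 2 * n * r * (u x * e x) \<partial>?M)"
    unfolding lap by (simp add: algebra_simps)
  also have "\<dots> = 4 * r\<^sup>2 * V1 - 2 * n * r * V"
    using int_e int_fe by (simp add: V_def V1_def)
  finally have sub: "2 * n * r * V - 4 * r\<^sup>2 * V1 \<le> l * V" by simp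
  obtain F where F: "\<And>x. x \<in> \<Omega> \<Longrightarrow> norm (f x) \<le> F"
    using continuous_bounded_on[OF \<Omega>(2) smooth_continuous[OF sf]] by metis
  have "((\<lambda>s. \<integral>x. u x * exp (- s * f x) \<partial>?M) has_real_derivative
      - (\<integral>x. u x * f x * exp (- r * f x) \<partial>?M)) (at r)"
  proof (rule laplace_transform_has_derivative[OF int_u _ _ _ r, of _ F])
    show "f \<in> borel_measurable ?M"
      by (rule continuous_measurable_lebesgue_on[OF \<Omega>(1) smooth_continuous[OF sf]])
    show "0 \<le> f x" for x by (simp add: f_def)
    show "f x \<le> F" if "x \<in> space ?M" for x
      using F[of x] that by (simp add: space_restrict_space)
  qed
  then have dV: "((\<lambda>s. \<integral>x. u x * exp (- s * f x) \<partial>?M) has_real_derivative - V1) (at r)"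
    by (simp add: V1_def e_def mult.assoc)
  define A where "A = exp (l / (4 * r) + n / 2 * ln r)"
  have dA: "((\<lambda>s. exp (l / (4 * s) + n / 2 * ln s)) has_real_derivative
      A * (- l / (4 * r\<^sup>2) + n / (2 * r))) (at r)"
    unfolding A_def using r
    by (auto intro!: derivative_eq_intros simp: field_simps power2_eq_square)
  have "(W has_real_derivative A * (- l / (4 * r\<^sup>2) + n / (2 * r)) * V + (- V1) * A) (at r)"
    using DERIV_mult[OF dA dV] unfolding W_def f_def[symmetric] n_def[symmetric] A_def V_def e_def .
  \<comment> \<open>The derivative is a positive factor times the defect in \<open>sub\<close>.
    Decreasing in \<open>s\<close> means increasing in the heat time 1/(4s).\<close>
  moreover have "A * (- l / (4 * r\<^sup>2) + n / (2 * r)) * V + (- V1) * A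
      = A / (4 * r\<^sup>2) * (2 * n * r * V - 4 * r\<^sup>2 * V1 - l * V)"
    using r by (simp add: field_simps power2_eq_square)
  moreover have "\<dots> \<le> 0"
    using sub by (intro mult_nonneg_nonpos) (auto simp: A_def)
  ultimately show "\<exists>y. (W has_real_derivative y) (at r) \<and> y \<le> 0" by metis
qed


section \<open>Rescaled Gaussians and their concentration at a point\<close>

lemma integral_gaussian_rescale:
  fixes z :: "real ^ 'n"
  assumes \<sigma>: "\<sigma> > 0" and [measurable]: "v \<in> borel_measurable borel"
  shows "\<sigma> ^ CARD('n) * (\<integral>x. v x * exp (- \<sigma>\<^sup>2 * ((x - z) \<bullet> (x - z))) \<partial>lborel)
    = (\<integral>y. v (z + (1 / \<sigma>) *\<^sub>R y) * gaussian y \<partial>lborel)"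
proof -
  have "(\<integral>x. v x * exp (- \<sigma>\<^sup>2 * ((x - z) \<bullet> (x - z))) \<partial>lborel)
      = \<bar>1 / \<sigma>\<bar> ^ DIM(real ^ 'n) * (\<integral>y. v (z + (1 / \<sigma>) *\<^sub>R y)
          * exp (- \<sigma>\<^sup>2 * ((z + (1 / \<sigma>) *\<^sub>R y - z) \<bullet> (z + (1 / \<sigma>) *\<^sub>R y - z))) \<partial>lborel)"
    using \<sigma> by (intro lborel_integral_affine) auto
  also have "\<dots> = (1 / \<sigma>) ^ CARD('n) * (\<integral>y. v (z + (1 / \<sigma>) *\<^sub>R y) * gaussian y \<partial>lborel)"
    using \<sigma> by (simp add: gaussian_def power2_eq_square)
  finally show ?thesis
    using \<sigma> by (simp add: power_divide)
qed

lemma integrable_gaussian_rescale: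
  fixes z :: "real ^ 'n"
  assumes "\<sigma> > 0"
  shows "integrable lborel (\<lambda>x. exp (- \<sigma>\<^sup>2 * ((x - z) \<bullet> (x - z))))"
proof (rule integrable_lborel_affine[where c="1 / \<sigma>" and t=z])
  show "integrable lborel (\<lambda>y. exp (- \<sigma>\<^sup>2 * ((z + (1 / \<sigma>) *\<^sub>R y - z) \<bullet> (z + (1 / \<sigma>) *\<^sub>R y - z))))"
    using integrable_gaussian[where 'a="real ^ 'n"] assms
    by (simp add: gaussian_def[abs_def] power2_eq_square)
qed (use assms in auto)

text \<open>After rescaling, the Gaussian is fixed and the argument of \<open>v\<close> shrinks to
  \<open>z\<close>, so dominated convergence with majorant \<open>B * gaussian y\<close> applies.
  Continuity is asked at \<open>z\<close> alone because the function in question is a zero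
  extension, whose continuity across the boundary is not established.\<close>

lemma gaussian_average_tendsto:
  fixes z :: "real ^ 'n"
  assumes [measurable]: "v \<in> borel_measurable borel" and cont: "isCont v z"
    and bound: "\<And>x. \<bar>v x\<bar> \<le> B"
  shows "(\<lambda>j. real (Suc j) ^ CARD('n) * (\<integral>x. v x * exp (- (real (Suc j))\<^sup>2 * ((x - z) \<bullet> (x - z))) \<partial>lborel))
    \<longlonglongrightarrow> v z * gaussian_mass TYPE(real ^ 'n)"
proof -
  have "(\<lambda>j. \<integral>y. v (z + (1 / real (Suc j)) *\<^sub>R y) * gaussian y \<partial>lborel)
      \<longlonglongrightarrow> (\<integral>(y :: real ^ 'n). v z * gaussian y \<partial>lborel)"
  proof (rule integral_dominated_convergence)
    show "integrable lborel (\<lambda>y :: real ^ 'n. B * gaussian y)"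
      by (intro integrable_mult_right integrable_gaussian)
    show "AE y in lborel. (\<lambda>j. v (z + (1 / real (Suc j)) *\<^sub>R y) * gaussian y) \<longlonglongrightarrow> v z * gaussian y"
    proof (rule AE_I2)
      fix y
      have "(\<lambda>j. z + (1 / real (Suc j)) *\<^sub>R y) \<longlonglongrightarrow> z + 0 *\<^sub>R y"
        by (intro tendsto_intros LIMSEQ_Suc[OF lim_1_over_n])
      then have "(\<lambda>j. v (z + (1 / real (Suc j)) *\<^sub>R y)) \<longlonglongrightarrow> v z"
        using isCont_tendsto_compose[OF cont] by simp
      then show "(\<lambda>j. v (z + (1 / real (Suc j)) *\<^sub>R y) * gaussian y) \<longlonglongrightarrow> v z * gaussian y"
        by (rule tendsto_mult_right)
    qed
    show "AE y in lborel. norm (v (z + (1 / real (Suc j)) *\<^sub>R y) * gaussian y) \<le> B * gaussian y" for j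
      by (intro AE_I2)
        (simp add: abs_mult bound mult_right_mono gaussian_pos[THEN less_imp_le] del: of_nat_Suc)
  qed measurable
  moreover have "real (Suc j) ^ CARD('n)
      * (\<integral>x. v x * exp (- (real (Suc j))\<^sup>2 * ((x - z) \<bullet> (x - z))) \<partial>lborel)
      = (\<integral>y. v (z + (1 / real (Suc j)) *\<^sub>R y) * gaussian y \<partial>lborel)" for j
    by (rule integral_gaussian_rescale) simp_all
  ultimately show ?thesis
    by (simp only: gaussian_mass_def integral_mult_right_zero)
qed

text \<open>From 1 - x \<le> e^(-x) one gets \<open>b \<le> x * c\<close>. The denominator
  \<open>c + 1\<close> stays positive when \<open>c\<close> is merely known to be
  nonnegative.\<close>

lemma exp_growth_rate_ge:
  fixes c b x :: real
  assumes "0 \<le> c" "0 < b" and le: "c \<le> exp x * (c - b)"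
  shows "b / (c + 1) \<le> x"
proof -
  have "exp (- x) * c \<le> exp (- x) * (exp x * (c - b))"
    using le by (intro mult_left_mono) auto
  also have "\<dots> = c - b" by (simp add: exp_minus field_simps)
  finally have "exp (- x) * c \<le> c - b" .
  moreover have "(1 - x) * c \<le> exp (- x) * c"
    using exp_ge_add_one_self[of "- x"] \<open>0 \<le> c\<close> by (intro mult_right_mono) auto
  ultimately have *: "b \<le> x * c" by (simp add: algebra_simps)
  then have "0 < x" using assms(1,2) by (smt (verit) mult_nonneg_nonneg mult_nonneg_nonpos2 mult.commute)
  with * have "b \<le> x * (c + 1)" by (simp add: algebra_simps)
  then show ?thesis using \<open>0 \<le> c\<close> by (simp add: field_simps)
qed

text \<open>The heat average at \<open>z\<close> is compared at time 0, where it is the maximum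
  \<open>u z\<close>, and at time \<open>d^2 / 4\<close>. At the later time the Gaussian puts a
  definite weight on the part of \<open>ball y d\<close> outside \<Omega>, where the zero extension
  vanishes, so only the growth factor \<open>exp (l * d^2 / 4)\<close> can make up for the
  loss.\<close>

lemma max_point_boundary_distance:
  fixes \<Omega> :: "(real ^ 'n) set" and z :: "real ^ 'n"
  assumes \<Omega>: "open \<Omega>" "bounded \<Omega>" and u: "weak_solution \<Omega> l u g"
    and cont: "continuous_on \<Omega> u" and pos: "\<And>x. x \<in> \<Omega> \<Longrightarrow> 0 < u x"
    and z: "z \<in> \<Omega>" "\<And>x. x \<in> \<Omega> \<Longrightarrow> u x \<le> u z"
    and d: "d > 0" "dist z y \<le> d"
    and asym: "\<alpha> * measure lebesgue (ball y d) \<le> measure lebesgue (ball y d - \<Omega>)" and "\<alpha> > 0"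
  shows "exp (- 4) * \<alpha> * measure lebesgue (ball (0 :: real ^ 'n) 1) / (gaussian_mass TYPE(real ^ 'n) + 1)
    \<le> l * d\<^sup>2 / 4"
proof -
  define n where "n = CARD('n)"
  define c where "c = gaussian_mass TYPE(real ^ 'n)"
  define \<omega> where "\<omega> = measure lebesgue (ball (0 :: real ^ 'n) 1)"
  define b where "b = exp (- 4) * \<alpha> * \<omega>"
  define v where "v x = indicator \<Omega> x *\<^sub>R u x" for x
  define E where "E \<sigma> x = exp (- \<sigma>\<^sup>2 * ((x - z) \<bullet> (x - z)))" for \<sigma> x
  have E_pos: "0 < E \<sigma> x" for \<sigma> x by (simp add: E_def)
  have [measurable]: "v \<in> borel_measurable borel"
    unfolding v_def[abs_def] using \<Omega> cont by (intro borel_measurable_continuous_on_indicator) auto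
  have [measurable]: "E \<sigma> \<in> borel_measurable borel" for \<sigma>
    unfolding E_def[abs_def] by measurable
  have uz: "0 < u z" using pos z by blast
  have v: "0 \<le> v x" "v x \<le> u z" for x
    using pos[of x] z(2)[of x] uz by (auto simp: v_def indicator_def)
  have vz: "v z = u z" using z by (simp add: v_def)
  have "isCont v z"
  proof -
    have "\<forall>\<^sub>F x in nhds z. u x = v x"
      using eventually_nhds_in_open[OF \<Omega>(1) z(1)] by eventually_elim (simp add: v_def)
    then show ?thesis
      using cont \<Omega>(1) z(1) isCont_cong continuous_on_eq_continuous_at by blast
  qed
  \<comment> \<open>The monotone quantity of \<open>weak_solution_heat_monotone\<close> at
    \<open>s = \<sigma>^2\<close>; its factor \<open>exp (n / 2 * ln s)\<close> becomes
    \<open>\<sigma> ^ n\<close>.\<close>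
  define W where "W \<sigma> = exp (l / (4 * \<sigma>\<^sup>2)) * (\<sigma> ^ n * (\<integral>x. v x * E \<sigma> x \<partial>lborel))" for \<sigma>
  have W_mono: "W \<tau> \<le> W \<sigma>" if "0 < \<sigma>" "\<sigma> \<le> \<tau>" for \<sigma> \<tau>
  proof -
    have W: "W \<sigma> = exp (l / (4 * \<sigma>\<^sup>2) + real CARD('n) / 2 * ln (\<sigma>\<^sup>2))
      * (\<integral>x. u x * exp (- \<sigma>\<^sup>2 * ((x - z) \<bullet> (x - z))) \<partial>lebesgue_on \<Omega>)" if "\<sigma> > 0" for \<sigma>
    proof -
      have "real CARD('n) / 2 * ln (\<sigma>\<^sup>2) = real n * ln \<sigma>"
        using that by (simp add: n_def ln_realpow)
      then have "exp (real CARD('n) / 2 * ln (\<sigma>\<^sup>2)) = \<sigma> ^ n"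
        using that by (simp add: exp_of_nat_mult)
      moreover have "(\<integral>x. u x * exp (- \<sigma>\<^sup>2 * ((x - z) \<bullet> (x - z))) \<partial>lebesgue_on \<Omega>)
          = (\<integral>x. v x * E \<sigma> x \<partial>lebesgue_on \<Omega>)"
        by (intro Bochner_Integration.integral_cong) (auto simp: space_restrict_space v_def E_def)
      moreover have "\<dots> = (\<integral>x. v x * E \<sigma> x \<partial>lborel)"
      proof (rule integral_lebesgue_on_eq_lborel[OF \<Omega>(1)])
        show "(\<lambda>x. v x * E \<sigma> x) \<in> borel_measurable borel" by measurable
      qed (simp add: v_def)
      ultimately show ?thesis by (simp add: W_def exp_add)
    qed
    show ?thesis
      using weak_solution_heat_monotone[OF \<Omega> u pos, of "\<sigma>\<^sup>2" "\<tau>\<^sup>2" z] that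
      by (simp add: W power_mono)
  qed
  have "(\<lambda>j. W (real (Suc j))) \<longlonglongrightarrow> exp 0 * (u z * c)"
    unfolding W_def
  proof (rule tendsto_mult)
    have "(\<lambda>j. l / 4 * (1 / real (Suc j))\<^sup>2) \<longlonglongrightarrow> l / 4 * 0\<^sup>2"
      by (intro tendsto_intros LIMSEQ_Suc[OF lim_1_over_n])
    then have "(\<lambda>j. l / (4 * (real (Suc j))\<^sup>2)) \<longlonglongrightarrow> 0"
      by (simp add: power_divide del: of_nat_Suc)
    then show "(\<lambda>j. exp (l / (4 * (real (Suc j))\<^sup>2))) \<longlonglongrightarrow> exp 0"
      by (rule tendsto_exp)
    have "\<bar>v x\<bar> \<le> u z" for x using v[of x] by simp
    from gaussian_average_tendsto[OF _ \<open>isCont v z\<close> this]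
    show "(\<lambda>j. real (Suc j) ^ n * (\<integral>x. v x * E (real (Suc j)) x \<partial>lborel)) \<longlonglongrightarrow> u z * c"
      unfolding E_def c_def n_def vz by measurable
  qed
  \<comment> \<open>As \<open>W\<close> is nonincreasing in \<sigma>, its limit at infinity, which
    is the value at time 0, lies below \<open>W (1 / d)\<close>.\<close>
  moreover have "\<forall>\<^sub>F j in sequentially. W (real (Suc j)) \<le> W (1 / d)"
    using eventually_ge_at_top[of "nat \<lceil>1 / d\<rceil>"]
    by eventually_elim (use d in \<open>auto intro!: W_mono simp: nat_le_iff ceiling_le_iff\<close>)
  ultimately have lower: "u z * c \<le> W (1 / d)"
    using tendsto_upperbound[of _ _ sequentially "W (1 / d)"] by simp
  have int_E: "integrable lborel (E (1 / d))"
    unfolding E_def[abs_def] using d by (intro integrable_gaussian_rescale) simp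
  define S where "S = ball y d - \<Omega>"
  have S_meas: "S \<in> sets borel" using \<Omega> by (auto simp: S_def)
  have S_fin: "emeasure lborel S < \<infinity>"
  proof -
    have "emeasure lborel S \<le> emeasure lborel (ball y d)"
      by (intro emeasure_mono) (auto simp: S_def)
    then show ?thesis using emeasure_lborel_ball_finite[of y d] by (rule le_less_trans)
  qed
  have int_S: "integrable lborel (indicator S :: _ \<Rightarrow> real)"
    using S_meas S_fin by (intro integrable_real_indicator) auto
  have S_size: "\<alpha> * \<omega> * d ^ n \<le> measure lborel S"
  proof -
    have "measure lebesgue (ball y d) = d ^ n * \<omega>"
      using content_ball_conv_unit_ball[of d y] d by (simp add: \<omega>_def n_def)
    moreover have "measure lebesgue S = measure lborel S"
      using S_meas by simp
    ultimately show ?thesis using asym by (simp add: S_def mult_ac)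
  qed
  \<comment> \<open>Points of \<open>ball y d\<close> are within \<open>2 * d\<close> of
    \<open>z\<close>, so the exponent at scale \<open>1 / d\<close> is at least -4; this is the
    source of \<open>exp (- 4)\<close>.\<close>
  have E_S: "exp (- 4) \<le> E (1 / d) x" if "x \<in> S" for x
  proof -
    have "norm (x - z) \<le> 2 * d"
      using that d dist_triangle[of x z y] by (simp add: S_def dist_norm[symmetric] dist_commute)
    then have "(norm (x - z))\<^sup>2 \<le> (2 * d)\<^sup>2" by (rule power_mono) simp
    then have "(1 / d)\<^sup>2 * ((x - z) \<bullet> (x - z)) \<le> 4"
      using d by (simp add: power2_norm_eq_inner field_simps)
    then show ?thesis by (simp add: E_def)
  qed
  \<comment> \<open>Off \<open>S\<close> the maximum property gives \<open>v x \<le> u z\<close>; on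
    \<open>S\<close> the left side is 0, and \<open>E_S\<close> keeps the right side
    nonnegative.\<close>
  have "(\<integral>x. v x * E (1 / d) x \<partial>lborel) \<le> (\<integral>x. u z * (E (1 / d) x - exp (- 4) * indicator S x) \<partial>lborel)"
  proof (rule integral_mono_AE)
    show "integrable lborel (\<lambda>x. v x * E (1 / d) x)"
      by (rule Bochner_Integration.integrable_bound[OF integrable_mult_right[OF int_E, of "u z"]])
        (use v E_pos[of "1 / d"] uz in \<open>auto intro!: AE_I2 mult_mono simp: abs_mult less_imp_le\<close>)
    show "integrable lborel (\<lambda>x. u z * (E (1 / d) x - exp (- 4) * indicator S x))"
      by (intro integrable_mult_right Bochner_Integration.integrable_diff int_E int_S)
    show "AE x in lborel. v x * E (1 / d) x \<le> u z * (E (1 / d) x - exp (- 4) * indicator S x)"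
    proof (rule AE_I2)
      fix x
      show "v x * E (1 / d) x \<le> u z * (E (1 / d) x - exp (- 4) * indicator S x)"
      proof (cases "x \<in> S")
        case True
        then have "v x = 0" by (simp add: S_def v_def)
        then show ?thesis using True E_S[OF True] uz by simp
      next
        case False
        then show ?thesis using v(2)[of x] E_pos[of "1 / d" x] by (simp add: mult_right_mono)
      qed
    qed
  qed
  also have "\<dots> = u z * ((\<integral>x. E (1 / d) x \<partial>lborel) - exp (- 4) * measure lborel S)"
    using int_E int_S S_meas by simp
  also have "(\<integral>x. E (1 / d) x \<partial>lborel) = d ^ n * c"
    using integral_gaussian_rescale[of "1 / d" "\<lambda>_. 1" z] d
    by (simp add: E_def n_def c_def gaussian_mass_def field_simps)
  also have "u z * (d ^ n * c - exp (- 4) * measure lborel S) \<le> u z * (d ^ n * (c - b))"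
  proof (rule mult_left_mono)
    have "exp (- 4) * (\<alpha> * \<omega> * d ^ n) \<le> exp (- 4) * measure lborel S"
      using S_size by (rule mult_left_mono) simp
    then show "d ^ n * c - exp (- 4) * measure lborel S \<le> d ^ n * (c - b)"
      by (simp add: b_def algebra_simps)
  qed (use uz in simp)
  finally have "W (1 / d) \<le> exp (l / (4 * (1 / d)\<^sup>2)) * ((1 / d) ^ n * (u z * (d ^ n * (c - b))))"
    unfolding W_def using d by (intro mult_left_mono) auto
  also have "\<dots> = u z * (exp (l * d\<^sup>2 / 4) * (c - b))"
    using d by (simp add: power_divide)
  finally have "u z * c \<le> u z * (exp (l * d\<^sup>2 / 4) * (c - b))"
    using lower by linarith
  then have "c \<le> exp (l * d\<^sup>2 / 4) * (c - b)" using uz by simp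
  moreover have "0 < \<omega>"
    unfolding \<omega>_def using content_ball_pos[of 1 "0 :: real ^ 'n"] by simp
  then have "0 < b" using \<open>\<alpha> > 0\<close> by (simp add: b_def)
  moreover have "0 \<le> c" unfolding c_def by (rule gaussian_mass_nonneg)
  ultimately have "b / (c + 1) \<le> l * d\<^sup>2 / 4"
    by (intro exp_growth_rate_ge)
  then show ?thesis by (simp only: b_def c_def \<omega>_def)
qed

section \<open>Combination of the two eigenvalue bounds\<close>

theorem proposition3p1:
  fixes \<alpha> :: real
  assumes "\<alpha> > 0"
  shows "\<exists>C > 0. \<forall>(\<Omega> :: (real ^ 'n) set) \<phi> x0.
           domain \<Omega> \<and> bounded \<Omega> \<and> asymmetric \<alpha> \<Omega> \<and>
           ground_state \<Omega> \<phi> \<and> x0 \<in> \<Omega> \<and> (\<forall>x \<in> \<Omega>. \<phi> x \<le> \<phi> x0)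
           \<longrightarrow> ball x0 (C * inrad \<Omega>) \<subseteq> \<Omega>"
proof -
  define \<kappa> where "\<kappa> = exp (- 4) * \<alpha> * measure lebesgue (ball (0 :: real ^ 'n) 1)
    / (gaussian_mass TYPE(real ^ 'n) + 1)"
  \<comment> \<open>From \<open>\<kappa> \<le> \<lambda> * d^2 / 4\<close> and
    \<open>\<lambda> * r^2 \<le> 2 * (n + 5)^2\<close> one gets
    \<open>d^2 \<ge> 2 * \<kappa> * r^2 / (n + 5)^2\<close>, and \<open>C^2\<close> is the factor of
    \<open>r^2\<close>.\<close>
  define C where "C = sqrt (2 * \<kappa>) / (real CARD('n) + 5)"
  have "0 < measure lebesgue (ball (0 :: real ^ 'n) 1)"
    using content_ball_pos[of 1 "0 :: real ^ 'n"] by simp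
  moreover have "0 < gaussian_mass TYPE(real ^ 'n) + 1"
    using gaussian_mass_nonneg[where 'a="real ^ 'n"] by linarith
  ultimately have "0 < \<kappa>"
    unfolding \<kappa>_def using assms by (intro divide_pos_pos mult_pos_pos) auto
  have C: "0 < C" "C\<^sup>2 * (real CARD('n) + 5)\<^sup>2 = 2 * \<kappa>"
    using \<open>0 < \<kappa>\<close> by (simp_all add: C_def power_divide)
  have main: "ball x0 (C * inrad \<Omega>) \<subseteq> \<Omega>"
    if "domain \<Omega>" and bnd: "bounded \<Omega>" and asym: "asymmetric \<alpha> \<Omega>"
      and gs: "ground_state \<Omega> \<phi>" and x0: "x0 \<in> \<Omega>" "\<forall>x\<in>\<Omega>. \<phi> x \<le> \<phi> x0"
    for \<Omega> :: "(real ^ 'n) set" and \<phi> x0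
  proof -
    have op: "open \<Omega>" using \<open>domain \<Omega>\<close> by (simp add: domain_def)
    from gs obtain g where sol: "weak_solution \<Omega> (lambda1 \<Omega>) \<phi> g"
      unfolding ground_state_def dirichlet_eigenfunction_def weak_solution_def by blast
    have cont: "continuous_on \<Omega> \<phi>" and pos: "\<And>x. x \<in> \<Omega> \<Longrightarrow> 0 < \<phi> x"
      using gs by (auto simp: ground_state_def)
    have "\<Omega> \<noteq> UNIV" using bnd by auto
    then have "frontier \<Omega> \<noteq> {}" using x0(1) frontier_not_empty[of \<Omega>] by auto
    then obtain y where y: "y \<in> frontier \<Omega>" "\<And>w. w \<in> frontier \<Omega> \<Longrightarrow> dist x0 y \<le> dist x0 w"
      using distance_attains_inf[OF frontier_closed, of \<Omega> x0] by metis
    define d where "d = dist x0 y"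
    have "y \<notin> \<Omega>" using y(1) op by (simp add: frontier_def interior_open)
    then have "d > 0" using x0(1) by (auto simp: d_def)
    have sub: "ball x0 d \<subseteq> \<Omega>"
    proof (rule ccontr)
      assume "\<not> ball x0 d \<subseteq> \<Omega>"
      then have "ball x0 d - \<Omega> \<noteq> {}" by blast
      moreover have "x0 \<in> ball x0 d" using \<open>d > 0\<close> by simp
      then have "ball x0 d \<inter> \<Omega> \<noteq> {}" using x0(1) by blast
      \<comment> \<open>A ball is connected, so meeting both \<Omega> and its complement forces it
        to meet the frontier, at a point nearer to \<open>x0\<close> than \<open>y\<close>.\<close>
      ultimately have "ball x0 d \<inter> frontier \<Omega> \<noteq> {}"
        using connected_Int_frontier[OF connected_ball] by metis
      then obtain w where "w \<in> ball x0 d" "w \<in> frontier \<Omega>" by blast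
      then show False using y(2)[of w] by (simp add: d_def)
    qed
    have exterior: "\<alpha> * measure lebesgue (ball y d) \<le> measure lebesgue (ball y d - \<Omega>)"
    proof -
      have "\<alpha> \<le> measure lebesgue (ball y d - \<Omega>) / measure lebesgue (ball y d)"
        using asym y(1) \<open>d > 0\<close> by (simp add: asymmetric_def)
      moreover have "0 < measure lebesgue (ball y d)"
        using content_ball_pos[OF \<open>d > 0\<close>, of y] by simp
      ultimately show ?thesis by (simp add: le_divide_eq)
    qed
    have lower: "\<kappa> \<le> lambda1 \<Omega> * d\<^sup>2 / 4"
      unfolding \<kappa>_def
    proof (rule max_point_boundary_distance[OF op bnd sol cont pos x0(1) _ \<open>d > 0\<close> _ exterior assms])
      show "\<phi> x \<le> \<phi> x0" if "x \<in> \<Omega>" for x using x0(2) that by (rule bspec)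
      show "dist x0 y \<le> d" by (simp add: d_def)
    qed
    have le: "C * r \<le> d" if "r > 0" "ball w r \<subseteq> \<Omega>" for w r
    proof -
      \<comment> \<open>The bump wants a closed ball inside \<Omega>, while the inner radius is
        defined by open balls; halving the radius bridges this and costs a factor 4.\<close>
      have "cball w (r / 2) \<subseteq> ball w r" using \<open>r > 0\<close> by (simp add: cball_subset_ball_iff)
      then have "cball w (r / 2) \<subseteq> \<Omega>" using that(2) by (rule subset_trans)
      with \<open>r > 0\<close> have "lambda1 \<Omega> \<le> (real CARD('n) + 5)\<^sup>2 / (2 * (r / 2)\<^sup>2)"
        by (intro positive_weak_solution_eigenvalue_le[OF op bnd sol pos, of "r / 2" w]) simp_all
      then have upper: "lambda1 \<Omega> * r\<^sup>2 \<le> 2 * (real CARD('n) + 5)\<^sup>2"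
        using \<open>r > 0\<close> by (simp add: field_simps)
      have "2 * ((real CARD('n) + 5)\<^sup>2 * (C * r)\<^sup>2) = 4 * \<kappa> * r\<^sup>2"
        using C(2) by (simp add: power_mult_distrib)
      also have "\<dots> \<le> lambda1 \<Omega> * d\<^sup>2 * r\<^sup>2"
        using lower by (intro mult_right_mono) auto
      also have "\<dots> = (lambda1 \<Omega> * r\<^sup>2) * d\<^sup>2" by (simp only: mult_ac)
      also have "\<dots> \<le> (2 * (real CARD('n) + 5)\<^sup>2) * d\<^sup>2"
        using upper by (rule mult_right_mono) simp
      finally have "(real CARD('n) + 5)\<^sup>2 * (C * r)\<^sup>2 \<le> (real CARD('n) + 5)\<^sup>2 * d\<^sup>2" by simp
      then have "(C * r)\<^sup>2 \<le> d\<^sup>2"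
        by (rule mult_left_le_imp_le) simp
      then show ?thesis by (rule power2_le_imp_le) (use \<open>d > 0\<close> in simp)
    qed
    have "inrad \<Omega> \<le> d / C"
      unfolding inrad_def
    proof (rule cSup_least)
      \<comment> \<open>\<open>d\<close> is itself the radius of an inscribed ball, so the supremum
        is over a nonempty set and the uniform bound \<open>d / C\<close> carries over to
        it.\<close>
      have "d \<in> {r. 0 < r \<and> (\<exists>x. ball x r \<subseteq> \<Omega>)}"
        using \<open>d > 0\<close> sub by (intro CollectI conjI exI[of _ x0])
      then show "{r. 0 < r \<and> (\<exists>x. ball x r \<subseteq> \<Omega>)} \<noteq> {}" by (metis empty_iff)
      show "r \<le> d / C" if "r \<in> {r. 0 < r \<and> (\<exists>x. ball x r \<subseteq> \<Omega>)}" for r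
        using le[of r] that C(1) by (auto simp: le_divide_eq mult.commute)
    qed
    then have "C * inrad \<Omega> \<le> d" using C(1) by (simp add: field_simps)
    from subset_trans[OF subset_ball[OF this] sub] show ?thesis .
  qed
  show ?thesis
    by (intro exI[of _ C] conjI C(1) allI impI, elim conjE) (rule main)
qed

end
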